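(* Let $\alpha\in(0,1)$, $\rho>0$, $\tau>0$, $\delta\in(0,1)$, and let $E$ be a univariate distribution with $\mathbb P_{Z\sim E}(Z=0)\ge\alpha$. Suppose $\mathcal A$ is an algorithm that, given $n$ i.i.d. samples from $P_{\beta,E}$ for any $\beta\in\mathbb R^d$, outputs with probability at least $1-\delta$ an estimate $\widehat\beta$ with $\|\widehat\beta-\beta\|_2\le\tau$. Let $\mathcal A'$ be the algorithm which takes $2n$ samples $S=\{(x_i,y_i)\}_{i=1}^n$, $S'=\{(x_i',y_i')\}_{i=1}^n$ and: samples a uniformly random rotation matrix $U\in\mathbb R^{d\times d}$; sets $\widehat\beta_1=\mathcal A(S)$; sets $w=\mathcal A(\{(Ux_i',y_i')\}_{i=1}^n)$ and $\widehat\beta_2=U^\top w$; computes $W=\langle\widehat\beta_1/\|\widehat\beta_1\|_2,\widehat\beta_2/\|\widehat\beta_2\|_2\rangle$; outputs "alternate" if $|W|>1/9$ and "null" otherwise. If $\tau\le\rho/4$ and $d\ge C\log(1/\delta)$ for a sufficiently large absolute constant $C$, then $\mathcal A'$ solves the testing problem $\mathrm{Test}(d,\rho,E)$ (outputs the correct hypothesis) with probability at least $1-2\delta$.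
   Context: $P_{\beta,E}$: distribution of $(x,y)$ with $x\sim\mathcal N(0,I_d)$ and $y=x^\top\beta+Z$, $Z\sim E$ independent of $x$. $R^*_{\rho,E}$: law of $G+z$ with $G\sim\mathcal N(0,\rho^2)$, $z\sim E$ independent. Testing problem $\mathrm{Test}(d,\rho,E)$: distinguish the null, in which $x\sim\mathcal N(0,I_d)$ and $y\sim R^*_{\rho,E}$ independently, from the alternate, in which a unit vector $v$ is drawn uniformly and then samples come from $P_{\rho v,E}$; samples are i.i.d. from the chosen distribution. *)

theory Defs
  imports "HOL-Probability.Probability" "Jordan_Normal_Form.Determinant"
begin

text \<open>
  The constant in the theorem must not depend on the dimension, so the dimension \<open>d\<close> is a natural
  number: \<open>\<real>\<^sup>d\<close> is the space of extensional functions on \<open>{..<d}\<close>, and a \<open>d \<times> d\<close> matrix is the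
  extensional family of its rows.
\<close>

definition vec_space :: "nat \<Rightarrow> (nat \<Rightarrow> real) measure" where
  "vec_space d = Pi\<^sub>M {..<d} (\<lambda>_. borel)"

definition mat_space :: "nat \<Rightarrow> (nat \<Rightarrow> nat \<Rightarrow> real) measure" where
  "mat_space d = Pi\<^sub>M {..<d} (\<lambda>_. vec_space d)"

definition dot :: "nat \<Rightarrow> (nat \<Rightarrow> real) \<Rightarrow> (nat \<Rightarrow> real) \<Rightarrow> real" where
  "dot d x y = (\<Sum>i<d. x i * y i)"

definition vnorm :: "nat \<Rightarrow> (nat \<Rightarrow> real) \<Rightarrow> real" where
  "vnorm d x = L2_set x {..<d}"

definition vscale :: "nat \<Rightarrow> real \<Rightarrow> (nat \<Rightarrow> real) \<Rightarrow> nat \<Rightarrow> real" where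
  "vscale d c x = (\<lambda>i\<in>{..<d}. c * x i)"

definition vdiff :: "nat \<Rightarrow> (nat \<Rightarrow> real) \<Rightarrow> (nat \<Rightarrow> real) \<Rightarrow> nat \<Rightarrow> real" where
  "vdiff d x y = (\<lambda>i\<in>{..<d}. x i - y i)"

text \<open>Since \<open>1 / 0 = 0\<close>, the zero vector is mapped to itself.\<close>

definition normalize_vec :: "nat \<Rightarrow> (nat \<Rightarrow> real) \<Rightarrow> nat \<Rightarrow> real" where
  "normalize_vec d x = vscale d (1 / vnorm d x) x"

definition mat_app :: "nat \<Rightarrow> (nat \<Rightarrow> nat \<Rightarrow> real) \<Rightarrow> (nat \<Rightarrow> real) \<Rightarrow> nat \<Rightarrow> real" where
  "mat_app d U x = (\<lambda>i\<in>{..<d}. dot d (U i) x)"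

definition mat_mul ::
    "nat \<Rightarrow> (nat \<Rightarrow> nat \<Rightarrow> real) \<Rightarrow> (nat \<Rightarrow> nat \<Rightarrow> real) \<Rightarrow> nat \<Rightarrow> nat \<Rightarrow> real" where
  "mat_mul d U V = (\<lambda>i\<in>{..<d}. \<lambda>j\<in>{..<d}. \<Sum>k<d. U i k * V k j)"

definition mat_transp :: "nat \<Rightarrow> (nat \<Rightarrow> nat \<Rightarrow> real) \<Rightarrow> nat \<Rightarrow> nat \<Rightarrow> real" where
  "mat_transp d U = (\<lambda>i\<in>{..<d}. \<lambda>j\<in>{..<d}. U j i)"

definition mat_id :: "nat \<Rightarrow> nat \<Rightarrow> nat \<Rightarrow> real" where
  "mat_id d = (\<lambda>i\<in>{..<d}. \<lambda>j\<in>{..<d}. if i = j then 1 else 0)"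

definition is_rotation :: "nat \<Rightarrow> (nat \<Rightarrow> nat \<Rightarrow> real) \<Rightarrow> bool" where
  "is_rotation d U \<longleftrightarrow>
     U \<in> space (mat_space d) \<and>
     mat_mul d U (mat_transp d U) = mat_id d \<and>
     Determinant.det (Matrix.mat d d (\<lambda>(i, j). U i j)) = 1"

text \<open>
  The uniform distribution on rotation matrices is the normalised Haar measure of \<open>SO(d)\<close>, i.e.
  the (unique) probability measure on \<open>SO(d)\<close> that is invariant under left translations.
\<close>

definition uniform_rotation :: "nat \<Rightarrow> (nat \<Rightarrow> nat \<Rightarrow> real) measure \<Rightarrow> bool" where
  "uniform_rotation d \<mu> \<longleftrightarrow>
     prob_space \<mu> \<and>
     sets \<mu> = sets (mat_space d) \<and>
     (AE U in \<mu>. is_rotation d U) \<and>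
     (\<forall>R. is_rotation d R \<longrightarrow> distr \<mu> (mat_space d) (mat_mul d R) = \<mu>)"

text \<open>
  The normalised surface measure of the unit sphere, as the cone measure: a set \<open>A\<close> of unit vectors
  has measure \<open>vol {r x | r \<in> (0,1], x \<in> A} / vol B\<close>, where \<open>B\<close> is the unit ball.
\<close>

definition uniform_sphere :: "nat \<Rightarrow> (nat \<Rightarrow> real) measure" where
  "uniform_sphere d =
     distr (uniform_measure (Pi\<^sub>M {..<d} (\<lambda>_. lborel)) {x \<in> space (vec_space d). vnorm d x \<le> 1})
       (vec_space d) (normalize_vec d)"

definition std_gauss :: "nat \<Rightarrow> (nat \<Rightarrow> real) measure" where
  "std_gauss d = Pi\<^sub>M {..<d} (\<lambda>_. density lborel (\<lambda>t. ennreal (std_normal_density t)))"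

definition P_model :: "nat \<Rightarrow> (nat \<Rightarrow> real) \<Rightarrow> real measure \<Rightarrow> ((nat \<Rightarrow> real) \<times> real) measure" where
  "P_model d \<beta> E =
     distr (std_gauss d \<Otimes>\<^sub>M E) (vec_space d \<Otimes>\<^sub>M borel) (\<lambda>(x, z). (x, dot d x \<beta> + z))"

definition R_star :: "real \<Rightarrow> real measure \<Rightarrow> real measure" where
  "R_star \<rho> E =
     distr (density lborel (\<lambda>t. ennreal (normal_density 0 \<rho> t)) \<Otimes>\<^sub>M E) borel (\<lambda>(g, z). g + z)"

type_synonym samples = "nat \<Rightarrow> (nat \<Rightarrow> real) \<times> real"

definition iid :: "nat \<Rightarrow> 'a measure \<Rightarrow> (nat \<Rightarrow> 'a) measure" where
  "iid n D = Pi\<^sub>M {..<n} (\<lambda>_. D)"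

definition sample_space :: "nat \<Rightarrow> nat \<Rightarrow> samples measure" where
  "sample_space d n = iid n (vec_space d \<Otimes>\<^sub>M borel)"

text \<open>
  A randomised algorithm is a Markov kernel: it maps its input to the law of its output, and every
  call uses fresh randomness.
\<close>

definition is_estimator :: "nat \<Rightarrow> nat \<Rightarrow> (samples \<Rightarrow> (nat \<Rightarrow> real) measure) \<Rightarrow> bool" where
  "is_estimator d n A \<longleftrightarrow> A \<in> sample_space d n \<rightarrow>\<^sub>M prob_algebra (vec_space d)"

definition estimates_within ::
    "nat \<Rightarrow> nat \<Rightarrow> real measure \<Rightarrow> real \<Rightarrow> real \<Rightarrow> (samples \<Rightarrow> (nat \<Rightarrow> real) measure) \<Rightarrow> bool" where
  "estimates_within d n E \<tau> \<delta> A \<longleftrightarrow>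
     (\<forall>\<beta> \<in> space (vec_space d).
        measure (iid n (P_model d \<beta> E) \<bind> A)
          {b \<in> space (vec_space d). vnorm d (vdiff d b \<beta>) \<le> \<tau>} \<ge> 1 - \<delta>)"

datatype hypothesis = Null | Alternate

definition null_data :: "nat \<Rightarrow> nat \<Rightarrow> real \<Rightarrow> real measure \<Rightarrow> (samples \<times> samples) measure" where
  "null_data d n \<rho> E =
     iid n (std_gauss d \<Otimes>\<^sub>M R_star \<rho> E) \<Otimes>\<^sub>M iid n (std_gauss d \<Otimes>\<^sub>M R_star \<rho> E)"

text \<open>The hidden direction \<open>v\<close> is drawn once and shared by all \<open>2n\<close> samples.\<close>

definition alternate_data :: "nat \<Rightarrow> nat \<Rightarrow> real \<Rightarrow> real measure \<Rightarrow> (samples \<times> samples) measure" where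
  "alternate_data d n \<rho> E =
     uniform_sphere d \<bind> (\<lambda>v.
       iid n (P_model d (vscale d \<rho> v) E) \<Otimes>\<^sub>M iid n (P_model d (vscale d \<rho> v) E))"

definition solves_test ::
    "nat \<Rightarrow> nat \<Rightarrow> real \<Rightarrow> real measure \<Rightarrow> (samples \<times> samples \<Rightarrow> hypothesis measure) \<Rightarrow> real \<Rightarrow> bool"
  where
  "solves_test d n \<rho> E T p \<longleftrightarrow>
     measure (null_data d n \<rho> E \<bind> T) {Null} \<ge> p \<and>
     measure (alternate_data d n \<rho> E \<bind> T) {Alternate} \<ge> p"

definition rotate_samples :: "nat \<Rightarrow> nat \<Rightarrow> (nat \<Rightarrow> nat \<Rightarrow> real) \<Rightarrow> samples \<Rightarrow> samples" where
  "rotate_samples d n U S = (\<lambda>i\<in>{..<n}. (mat_app d U (fst (S i)), snd (S i)))"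

definition rotation_test ::
    "nat \<Rightarrow> nat \<Rightarrow> (nat \<Rightarrow> nat \<Rightarrow> real) measure \<Rightarrow> (samples \<Rightarrow> (nat \<Rightarrow> real) measure)
      \<Rightarrow> samples \<times> samples \<Rightarrow> hypothesis measure" where
  "rotation_test d n \<mu> A = (\<lambda>(S, S').
     do {
       U \<leftarrow> \<mu>;
       b1 \<leftarrow> A S;
       w \<leftarrow> A (rotate_samples d n U S');
       let b2 = mat_app d (mat_transp d U) w;
       let W = dot d (normalize_vec d b1) (normalize_vec d b2);
       return (count_space UNIV) (if \<bar>W\<bar> > 1 / 9 then Alternate else Null)
     })"

end

(*
  Under the alternate, rotating the covariates of a sample with regression vector \<beta> gives a sample
  with regression vector U \<beta>, so both estimates are within \<rho>/4 of the same vector of length \<rho>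
  with probability at least 1 - 2 \<delta>, and then their normalised inner product exceeds 1/9.
  Under the null, the Gaussian covariates are rotation invariant, so w does not depend on U and W is
  the inner product of a fixed unit vector with a uniformly rotated one. By invariance that fixed
  vector may be averaged over the normalised sign vectors, and Chernoff's bound for Rademacher sums
  gives P(|W| > 1/9) \<le> 2 exp(- d / 162).
*)

theory Submission
  imports Defs
begin

text \<open>The law \<open>\<mu>\<close> is invariant only under matrices of determinant 1, so one
  unit vector has to be carried to another inside this smaller group. Two reflections do it, except
  between antipodal vectors; there the absolute value in the event makes the two vectors
  interchangeable. In dimension 1 this exception cannot be avoided, because the only rotation is the
  identity. Averaging over sign vectors turns the tail of a coordinate on the sphere into a finite
  count, so no surface integral is evaluated. As the dimension is a number and not a type, rotation
  invariance of Lebesgue measure is derived for the product measure itself, by the argument that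
  proves uniqueness of Haar measure. The constant is 162 = 2 * 9^2. With it
  \<open>exp (- d / 162) \<le> \<delta>\<close>, so the null error
  \<open>2 * exp (- d / 162)\<close> meets the same bound \<open>2 * \<delta>\<close> as the union
  bound under the alternate. There the threshold 1/9 leaves room: the correlation is at least
  7/25.\<close>

section \<open>Inner products and orthogonality in coordinates\<close>

lemma dot_commute: "dot d x y = dot d y x"
  by (simp add: dot_def mult.commute)

lemma dot_cong: "(\<And>i. i < d \<Longrightarrow> x i = x' i) \<Longrightarrow> (\<And>i. i < d \<Longrightarrow> y i = y' i) \<Longrightarrow> dot d x y = dot d x' y'"
  by (simp add: dot_def)

lemma dot_add_left: "dot d (\<lambda>i. x i + y i) z = dot d x z + dot d y z"
  and dot_diff_left: "dot d (\<lambda>i. x i - y i) z = dot d x z - dot d y z"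
  and dot_scale_left: "dot d (\<lambda>i. c * x i) z = c * dot d x z"
  and dot_add_right: "dot d z (\<lambda>i. x i + y i) = dot d z x + dot d z y"
  and dot_diff_right: "dot d z (\<lambda>i. x i - y i) = dot d z x - dot d z y"
  and dot_scale_right: "dot d z (\<lambda>i. c * x i) = c * dot d z x"
  by (simp_all add: dot_def algebra_simps sum.distrib sum_subtractf sum_distrib_left)

lemmas dot_linear = dot_add_left dot_diff_left dot_scale_left
  dot_add_right dot_diff_right dot_scale_right

lemma dot_self_nonneg: "dot d x x \<ge> 0"
  by (simp add: dot_def sum_nonneg)

lemma dot_self_eq_0_iff: "dot d x x = 0 \<longleftrightarrow> (\<forall>i<d. x i = 0)"
  by (auto simp: dot_def sum_nonneg_eq_0_iff)

lemma vnorm_eq_sqrt_dot: "vnorm d x = sqrt (dot d x x)"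
  by (simp add: vnorm_def L2_set_def dot_def power2_eq_square)

lemma vnorm_power2: "(vnorm d x)\<^sup>2 = dot d x x"
  by (simp add: vnorm_eq_sqrt_dot dot_self_nonneg)

lemma vnorm_nonneg: "vnorm d x \<ge> 0"
  by (simp add: vnorm_eq_sqrt_dot dot_self_nonneg)

lemma space_vec_space: "space (vec_space d) = extensional {..<d}"
  by (simp add: vec_space_def space_PiM PiE_def)

lemma mat_app_in_space [simp]: "mat_app d U x \<in> extensional {..<d}"
  by (simp add: mat_app_def)

lemma dot_restrict [simp]:
  "dot d (restrict x {..<d}) y = dot d x y" "dot d x (restrict y {..<d}) = dot d x y"
  by (auto intro: dot_cong)

lemma dot_mat_app_left: "dot d (mat_app d U x) y = dot d x (mat_app d (mat_transp d U) y)"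
proof -
  have "dot d (mat_app d U x) y = (\<Sum>i<d. \<Sum>j<d. U i j * x j * y i)"
    by (simp add: dot_def mat_app_def sum_distrib_right)
  also have "\<dots> = (\<Sum>j<d. \<Sum>i<d. U i j * x j * y i)"
    by (rule sum.swap)
  also have "\<dots> = dot d x (mat_app d (mat_transp d U) y)"
    by (simp add: dot_def mat_app_def mat_transp_def sum_distrib_left mult_ac)
  finally show ?thesis .
qed

lemma mat_app_mat_mul: "mat_app d (mat_mul d U V) x = mat_app d U (mat_app d V x)"
proof (rule ext)
  fix i
  have "(\<Sum>j<d. (\<Sum>k<d. U i k * V k j) * x j) = (\<Sum>k<d. U i k * (\<Sum>j<d. V k j * x j))"
    unfolding sum_distrib_right sum_distrib_left by (subst sum.swap) (simp add: mult_ac)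
  then show "mat_app d (mat_mul d U V) x i = mat_app d U (mat_app d V x) i"
    by (simp add: mat_app_def mat_mul_def dot_def)
qed

lemma mat_app_mat_id: "mat_app d (mat_id d) x = restrict x {..<d}"
  by (auto simp: mat_app_def mat_id_def dot_def fun_eq_iff if_distrib[of "\<lambda>c. c * _"] cong: if_cong)

text \<open>\<open>is_rotation\<close> gives only the right inverse. That a right inverse of a
  square matrix is also a left inverse is a fact of finite dimension, available for the type
  \<open>real mat\<close>; the family of rows is therefore translated to that type and back.\<close>

lemma rotation_left_inverse:
  assumes "is_rotation d U"
  shows "mat_mul d (mat_transp d U) U = mat_id d"
proof -
  let ?A = "Matrix.mat d d (\<lambda>(i, j). U i j)" and ?B = "Matrix.mat d d (\<lambda>(i, j). U j i)"
  have 1: "mat_mul d U (mat_transp d U) i j = mat_id d i j" for i j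
    using assms by (simp add: is_rotation_def)
  have 2: "(\<Sum>k<d. U i k * U j k) = (if i = j then 1 else 0)" if "i < d" "j < d" for i j
    using 1[of i j] that by (simp add: mat_mul_def mat_transp_def mat_id_def)
  have "?A * ?B = 1\<^sub>m d"
    using 2 by (intro eq_matI) (simp_all add: scalar_prod_def lessThan_atLeast0)
  then have "?B * ?A = 1\<^sub>m d"
    by (intro mat_mult_left_right_inverse[of ?A d]) auto
  then have "(?B * ?A) $$ (i, j) = 1\<^sub>m d $$ (i, j)" for i j by simp
  have "(\<Sum>k<d. U k i * U k j) = (if i = j then 1 else 0)" if "i < d" "j < d" for i j
    using that \<open>(?B * ?A) $$ (i, j) = 1\<^sub>m d $$ (i, j)\<close>
    by (simp add: scalar_prod_def lessThan_atLeast0)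
  then show ?thesis
    by (auto simp: mat_mul_def mat_transp_def mat_id_def fun_eq_iff)
qed

lemma rotation_mat_app_transp:
  assumes "is_rotation d U" "x \<in> extensional {..<d}"
  shows "mat_app d U (mat_app d (mat_transp d U) x) = x"
    and "mat_app d (mat_transp d U) (mat_app d U x) = x"
  using assms rotation_left_inverse[OF assms(1)]
  by (simp_all flip: mat_app_mat_mul add: is_rotation_def mat_app_mat_id extensional_restrict)

lemma rotation_dot:
  assumes "is_rotation d U"
  shows "dot d (mat_app d U x) (mat_app d U y) = dot d x y"
proof -
  \<comment> \<open>The inverse law holds for extensional vectors only, but \<open>mat_app\<close>
    reads only the coordinates below \<open>d\<close>, so arbitrary functions may be restricted
    first.\<close>
  have "mat_app d U (restrict y {..<d}) = mat_app d U y"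
    by (simp add: mat_app_def)
  then show ?thesis
    using rotation_mat_app_transp(2)[OF assms restrict_extensional, of y]
    by (simp add: dot_mat_app_left)
qed

lemma rotation_transp_dot:
  assumes "is_rotation d U"
  shows "dot d (mat_app d (mat_transp d U) x) (mat_app d (mat_transp d U) y) = dot d x y"
proof -
  have "mat_app d (mat_transp d U) (restrict x {..<d}) = mat_app d (mat_transp d U) x"
    by (simp add: mat_app_def)
  then show ?thesis
    using rotation_mat_app_transp(1)[OF assms restrict_extensional, of x]
    by (metis dot_mat_app_left dot_commute dot_restrict(1))
qed

lemma rotation_vnorm: "is_rotation d U \<Longrightarrow> vnorm d (mat_app d U x) = vnorm d x"
  by (simp add: vnorm_eq_sqrt_dot rotation_dot)

lemma rotation_transp_vnorm:
  "is_rotation d U \<Longrightarrow> vnorm d (mat_app d (mat_transp d U) x) = vnorm d x"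
  by (simp add: vnorm_eq_sqrt_dot rotation_transp_dot)

subsection \<open>Rotations as products of two reflections\<close>

text \<open>The reflection in the hyperplane orthogonal to \<open>u\<close>; since \<open>x / 0 = 0\<close>, it is the identity
  for \<open>u = 0\<close>.\<close>

definition householder :: "nat \<Rightarrow> (nat \<Rightarrow> real) \<Rightarrow> real mat" where
  "householder d u =
     Matrix.mat d d (\<lambda>(i, j). (if i = j then 1 else 0) - 2 * u i * u j / dot d u u)"

lemma householder_carrier [simp]: "householder d u \<in> carrier_mat d d"
  by (simp add: householder_def)

lemma householder_mult_index:
  assumes "A \<in> carrier_mat d d" "i < d" "j < d"
  shows "(householder d u * A) $$ (i, j) =
    A $$ (i, j) - 2 * u i * (\<Sum>k<d. u k * A $$ (k, j)) / dot d u u"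
proof -
  have "(householder d u * A) $$ (i, j) =
      (\<Sum>k<d. ((if i = k then 1 else 0) - 2 * u i * u k / dot d u u) * A $$ (k, j))"
    using assms by (simp add: householder_def scalar_prod_def lessThan_atLeast0)
  also have "\<dots> = (\<Sum>k<d. (if i = k then A $$ (k, j) else 0)) -
      (\<Sum>k<d. 2 * u i / dot d u u * (u k * A $$ (k, j)))"
    unfolding sum_subtractf[symmetric] by (intro sum.cong) (auto simp: algebra_simps)
  also have "\<dots> = A $$ (i, j) - 2 * u i / dot d u u * (\<Sum>k<d. u k * A $$ (k, j))"
    unfolding sum_distrib_left using assms by simp
  finally show ?thesis by simp
qed

lemma sum_mult_householder:
  assumes "j < d"
  shows "(\<Sum>k<d. x k * householder d u $$ (k, j)) = x j - 2 * dot d x u * u j / dot d u u"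
proof -
  have "(\<Sum>k<d. x k * householder d u $$ (k, j)) =
      (\<Sum>k<d. (if k = j then x k else 0)) - (\<Sum>k<d. 2 * u j / dot d u u * (x k * u k))"
    unfolding sum_subtractf[symmetric]
    using assms by (intro sum.cong) (auto simp: householder_def algebra_simps)
  also have "\<dots> = x j - 2 * u j / dot d u u * dot d x u"
    unfolding sum_distrib_left[symmetric] using assms by (simp add: dot_def)
  finally show ?thesis by (simp add: mult_ac)
qed

lemma householder_mult_householder_index:
  assumes "i < d" "j < d"
  shows "(householder d u * householder d v) $$ (i, j) =
    (if i = j then 1 else 0) - 2 * v i * v j / dot d v v
      - 2 * u i * (u j - 2 * dot d u v * v j / dot d v v) / dot d u u"
  using assms by (subst householder_mult_index)
    (simp_all add: sum_mult_householder, simp add: householder_def)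

lemma householder_involution: "householder d u * householder d u = 1\<^sub>m d"
proof (rule eq_matI)
  fix i j assume "i < dim_row (1\<^sub>m d :: real mat)" "j < dim_col (1\<^sub>m d :: real mat)"
  then have "i < d" "j < d" by auto
  \<comment> \<open>For \<open>dot d u u = 0\<close> every quotient is a division by zero, hence 0,
    and the matrix is the identity.\<close>
  then show "(householder d u * householder d u) $$ (i, j) = 1\<^sub>m d $$ (i, j)"
    by (cases "dot d u u = 0") (simp_all add: householder_mult_householder_index)
qed (simp_all add: householder_def)

text \<open>Here \<open>w\<close> is the normal of the reflection that exchanges \<open>u\<close> and \<open>v\<close>.\<close>

lemma householder_conjugate:
  assumes "dot d u u = 1" "dot d v v = 1"
  defines "w \<equiv> \<lambda>i. u i - v i"
  shows "householder d w * householder d u = householder d v * householder d w"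
proof (rule eq_matI)
  fix i j
  assume "i < dim_row (householder d v * householder d w)"
    and "j < dim_col (householder d v * householder d w)"
  then have ij: "i < d" "j < d" by (auto simp: householder_def)
  define c where "c = dot d u v"
  have c: "dot d w w = 2 - 2 * c" "dot d w u = 1 - c" "dot d v w = c - 1"
    unfolding w_def by (simp_all add: dot_linear assms c_def dot_commute[of d v u])
  show "(householder d w * householder d u) $$ (i, j) = (householder d v * householder d w) $$ (i, j)"
  proof (cases "c = 1")
    \<comment> \<open>\<open>c = 1\<close> is the equality case of Cauchy-Schwarz: the squared
      length \<open>2 - 2 * c\<close> of \<open>w\<close> vanishes, so \<open>u\<close> and
      \<open>v\<close> agree and the reflection in \<open>w\<close> degenerates to the
      identity.\<close>
    case True
    then have "\<forall>k<d. w k = 0"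
      using c dot_self_eq_0_iff[of d w] by simp
    then have "w i = 0" "w j = 0" "u i = v i" "u j = v j"
      using ij by (auto simp: w_def)
    then show ?thesis
      using ij by (simp add: householder_mult_householder_index assms)
  next
    case False
    then have n: "2 - 2 * c \<noteq> 0" by simp
    \<comment> \<open>The inner products of \<open>w\<close> with \<open>u\<close> and with
      \<open>v\<close> are plus and minus half its squared length \<open>2 - 2 * c\<close>, so the
      mixed terms lose their denominator.\<close>
    have e: "2 * w i * (w j - 2 * (1 - c) * u j) / (2 - 2 * c)
        = 2 * w i * w j / (2 - 2 * c) - 2 * w i * u j"
      "2 * v i * (v j - 2 * (c - 1) * w j / (2 - 2 * c)) = 2 * v i * (v j + w j)"
      using n by (simp_all add: field_simps)
    show ?thesis
      using ij unfolding householder_mult_householder_index[OF ij] c assms(1,2) div_by_1 e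
      by (simp add: w_def algebra_simps)
  qed
qed (simp_all add: householder_def)

lemma det_householder_square: "Determinant.det (householder d u) * Determinant.det (householder d u) = 1"
  by (simp flip: det_mult[OF householder_carrier householder_carrier] add: householder_involution)

text \<open>Reflections in unit normals are conjugate to each other, and the conjugating reflection
  has nonzero determinant, which cancels. The common value -1 is never computed: a product of two
  such reflections needs only equal determinants whose square is 1.\<close>

lemma det_householder_eq:
  assumes "dot d u u = 1" "dot d v v = 1"
  shows "Determinant.det (householder d u) = Determinant.det (householder d v)"
proof -
  let ?w = "\<lambda>i. u i - v i"
  have "Determinant.det (householder d ?w * householder d u) =
      Determinant.det (householder d v * householder d ?w)"
    using householder_conjugate[OF assms] by simp
  then have "Determinant.det (householder d ?w) * Determinant.det (householder d u) =
      Determinant.det (householder d ?w) * Determinant.det (householder d v)"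
    by (simp add: det_mult[OF householder_carrier householder_carrier] mult.commute)
  then show ?thesis
    using det_householder_square[of d ?w] by auto
qed

lemma transpose_householder: "transpose_mat (householder d u) = householder d u"
  by (rule eq_matI) (auto simp: householder_def)

lemma is_rotation_of_mat:
  assumes A: "A \<in> carrier_mat d d" and AA: "A * transpose_mat A = 1\<^sub>m d"
    and det: "Determinant.det A = 1"
  shows "is_rotation d (\<lambda>i\<in>{..<d}. \<lambda>j\<in>{..<d}. A $$ (i, j))" (is "is_rotation d ?R")
  unfolding is_rotation_def
proof (intro conjI)
  show "?R \<in> space (mat_space d)"
    by (auto simp: mat_space_def vec_space_def space_PiM)
  have "(A * transpose_mat A) $$ (i, j) = 1\<^sub>m d $$ (i, j)" for i j using AA by simp
  have "(\<Sum>k<d. A $$ (i, k) * A $$ (j, k)) = (if i = j then 1 else 0)" if "i < d" "j < d" for i j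
    using that A \<open>(A * transpose_mat A) $$ (i, j) = 1\<^sub>m d $$ (i, j)\<close>
    by (simp add: scalar_prod_def lessThan_atLeast0)
  then show "mat_mul d ?R (mat_transp d ?R) = mat_id d"
    by (auto simp: mat_mul_def mat_transp_def mat_id_def fun_eq_iff)
  have "Matrix.mat d d (\<lambda>(i, j). ?R i j) = A"
    using A by (intro eq_matI) auto
  then show "Determinant.det (Matrix.mat d d (\<lambda>(i, j). ?R i j)) = 1"
    using det by simp
qed

text \<open>Let \<open>m\<close> be the normalised midpoint of \<open>b\<close> and
  \<open>c\<close>, which exists because they are not antipodal. The transpose of
  \<open>R = H_b H_m\<close> is \<open>H_m H_b\<close>: it first sends \<open>b\<close> to
  \<open>-b\<close>, and the reflection in \<open>m\<close> then sends \<open>-b\<close> to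
  \<open>2 <b, m> m - b = c\<close>. The conclusion speaks of the transpose because a factor
  \<open>R\<close> to the left of \<open>U\<close> reaches the fixed vector \<open>b\<close> through
  its adjoint.\<close>

lemma rotation_between_unit_vectors:
  assumes b: "dot d b b = 1" and c: "dot d c c = 1" and nc: "\<not> (\<forall>i<d. c i = - b i)"
  obtains R where "is_rotation d R" "\<And>i. i < d \<Longrightarrow> mat_app d (mat_transp d R) b i = c i"
proof -
  define m where "m = (\<lambda>i. (1 / vnorm d (\<lambda>i. b i + c i)) * (b i + c i))"
  define s where "s = vnorm d (\<lambda>i. b i + c i)"
  have s2: "s\<^sup>2 = 2 * (1 + dot d b c)"
    unfolding s_def vnorm_power2 by (simp add: dot_linear b c dot_commute[of d c b])
  have s0: "s \<noteq> 0"
    using nc by (auto simp: s_def vnorm_eq_sqrt_dot dot_self_eq_0_iff add_eq_0_iff)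
  have m: "m = (\<lambda>i. (1 / s) * (b i + c i))" by (simp add: m_def s_def)
  have "dot d m m = 1 / s\<^sup>2 * (2 * (1 + dot d b c))"
    unfolding m by (simp only: dot_linear b c dot_commute[of d c b])
      (simp add: field_simps power2_eq_square)
  then have mm: "dot d m m = 1"
    unfolding s2[symmetric] using s0 by simp
  have bm: "2 * dot d b m = s"
    unfolding m using s0 s2 by (simp only: dot_linear b c dot_commute[of d c b])
      (simp add: field_simps power2_eq_square)
  let ?A = "householder d b * householder d m"
  have A: "?A \<in> carrier_mat d d" by (rule mult_carrier_mat[of _ d d]) simp_all
  have T: "transpose_mat ?A = householder d m * householder d b"
    by (subst transpose_mult[of _ d d _ d]) (simp_all add: transpose_householder)
  have "?A * transpose_mat ?A = householder d b * (householder d m * (householder d m * householder d b))"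
    unfolding T by (rule assoc_mult_mat[of _ d d _ d _ d]) (auto intro: mult_carrier_mat[of _ d d])
  also have "householder d m * (householder d m * householder d b) = householder d b"
    by (subst assoc_mult_mat[symmetric, of _ d d _ d _ d])
      (simp_all add: householder_involution left_mult_one_mat[of _ d d])
  finally have AA: "?A * transpose_mat ?A = 1\<^sub>m d"
    by (simp add: householder_involution)
  have "Determinant.det ?A = 1"
    using det_householder_eq[OF mm b] det_householder_square[of d b]
    by (simp add: det_mult[of _ d])
  note rot = is_rotation_of_mat[OF A AA this]
  moreover have "mat_app d (mat_transp d (\<lambda>i\<in>{..<d}. \<lambda>j\<in>{..<d}. ?A $$ (i, j))) b i = c i"
    if i: "i < d" for i
  proof -
    have "mat_app d (mat_transp d (\<lambda>i\<in>{..<d}. \<lambda>j\<in>{..<d}. ?A $$ (i, j))) b i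
        = (\<Sum>k<d. b k * ?A $$ (k, i))"
      using i by (simp add: mat_app_def mat_transp_def dot_def mult.commute)
    \<comment> \<open>Since \<open>b\<close> is a unit vector, the left factor acts as
      \<open>1 - 2 * dot d b b = -1\<close> on the row \<open>b\<close>; what remains is the
      negative of \<open>b\<close> reflected in \<open>m\<close>.\<close>
    also have "\<dots> = (\<Sum>k<d. b k * householder d m $$ (k, i)
        - 2 * (b k * b k) * (\<Sum>l<d. b l * householder d m $$ (l, i)))"
      using i by (intro sum.cong) (auto simp: householder_mult_index b algebra_simps)
    also have "\<dots> = (\<Sum>k<d. b k * householder d m $$ (k, i))
        - 2 * dot d b b * (\<Sum>l<d. b l * householder d m $$ (l, i))"
      by (simp add: sum_subtractf dot_def flip: sum_distrib_right sum_distrib_left)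
    also have "\<dots> = (2 * dot d b m) * m i - b i"
      unfolding sum_mult_householder[OF i] b mm by simp
    also have "\<dots> = c i"
      unfolding bm using s0 by (simp add: m)
    finally show ?thesis .
  qed
  ultimately show thesis ..
qed

subsection \<open>Concentration\<close>

text \<open>This is Hoeffding's lemma for a fair sign. The library inequality with weight 1/2 at
  \<open>2 * x\<close> is its logarithm for \<open>x \<ge> 0\<close>, and both sides are
  even.\<close>

lemma cosh_le_exp_half_square: "cosh x \<le> exp (x\<^sup>2 / 2)" for x :: real
proof -
  have nonneg: "cosh x \<le> exp (x\<^sup>2 / 2)" if "x \<ge> 0" for x :: real
  proof -
    have "- x + ln (1 + (exp (2 * x) - 1) / 2) \<le> x\<^sup>2 / 2"
      using Hoeffdings_lemma_aux[of "2 * x" "1 / 2"] that by (simp add: power2_eq_square)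
    moreover have "1 + (exp (2 * x) - 1) / 2 = exp x * cosh x"
      by (simp add: cosh_field_def field_simps flip: exp_add)
    ultimately have "ln (cosh x) \<le> x\<^sup>2 / 2"
      by (simp add: ln_mult)
    then show ?thesis
      by (metis cosh_real_pos exp_le_cancel_iff exp_ln)
  qed
  show ?thesis
    using nonneg[of x] nonneg[of "- x"] by (cases "x \<ge> 0") auto
qed

text \<open>Chernoff's method in counting form: Markov's inequality for the exponential moment with
  parameter \<open>t\<close>, which is the minimiser of
  \<open>\<lambda>\<^sup>2 / 2 - \<lambda> * t\<close> because \<open>u\<close> is a unit vector.
  The factor \<open>2 ^ d\<close> is the number of sign vectors.\<close>

lemma signed_sum_upper_tail:
  fixes u :: "nat \<Rightarrow> real"
  assumes u: "dot d u u = 1" and t: "t \<ge> 0"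
  shows "real (card {s \<in> {..<d} \<rightarrow>\<^sub>E {-1, 1}. dot d s u > t}) \<le> 2 ^ d * exp (- t\<^sup>2 / 2)"
proof -
  let ?S = "{..<d} \<rightarrow>\<^sub>E {-1, 1::real}"
  have fin: "finite ?S" by (simp add: finite_PiE)
  have "real (card {s \<in> ?S. dot d s u > t}) * exp (t\<^sup>2) = (\<Sum>s\<in>{s \<in> ?S. dot d s u > t}. exp (t\<^sup>2))"
    by simp
  also have "\<dots> \<le> (\<Sum>s\<in>{s \<in> ?S. dot d s u > t}. exp (t * dot d s u))"
  proof (rule sum_mono)
    fix s assume "s \<in> {s \<in> ?S. dot d s u > t}"
    then have "t * t \<le> t * dot d s u"
      using t by (intro mult_left_mono) auto
    then show "exp (t\<^sup>2) \<le> exp (t * dot d s u)"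
      by (simp add: power2_eq_square)
  qed
  also have "\<dots> \<le> (\<Sum>s\<in>?S. exp (t * dot d s u))"
    using fin by (intro sum_mono2) auto
  also have "\<dots> = (\<Sum>s\<in>?S. \<Prod>i<d. exp (t * (s i * u i)))"
    by (simp add: dot_def sum_distrib_left exp_sum)
  \<comment> \<open>Independence of the signs appears here as distributivity: a sum over all sign
    vectors of a product factors over the coordinates.\<close>
  also have "\<dots> = (\<Prod>i<d. \<Sum>e\<in>{-1, 1}. exp (t * (e * u i)))"
    by (rule prod_sum_PiE[symmetric]) auto
  also have "\<dots> = (\<Prod>i<d. 2 * cosh (t * u i))"
    by (intro prod.cong) (simp_all add: cosh_field_def)
  also have "\<dots> \<le> (\<Prod>i<d. 2 * exp ((t * u i)\<^sup>2 / 2))"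
    by (intro prod_mono) (auto intro: cosh_le_exp_half_square)
  also have "\<dots> = 2 ^ d * exp (\<Sum>i<d. (t * u i)\<^sup>2 / 2)"
    by (simp add: prod.distrib exp_sum)
  also have "(\<Sum>i<d. (t * u i)\<^sup>2 / 2) = t\<^sup>2 / 2 * dot d u u"
    by (simp add: dot_def sum_distrib_left power2_eq_square mult_ac)
  also have "2 ^ d * exp (t\<^sup>2 / 2 * dot d u u) = 2 ^ d * exp (- t\<^sup>2 / 2) * exp (t\<^sup>2)"
    by (simp add: u mult.assoc flip: exp_add)
  finally show ?thesis by simp
qed

lemma signed_sum_tail:
  fixes u :: "nat \<Rightarrow> real"
  assumes u: "dot d u u = 1" and t: "t \<ge> 0"
  shows "real (card {s \<in> {..<d} \<rightarrow>\<^sub>E {-1, 1}. \<bar>dot d s u\<bar> > t}) \<le> 2 ^ d * (2 * exp (- t\<^sup>2 / 2))"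
proof -
  let ?S = "{..<d} \<rightarrow>\<^sub>E {-1, 1::real}"
  let ?v = "\<lambda>i. (-1) * u i"
  have v: "dot d ?v ?v = 1" "dot d s ?v = - dot d s u" for s
    by (simp_all only: dot_linear u)
  have fin: "finite ?S" by (simp add: finite_PiE)
  have "\<bar>dot d s u\<bar> > t \<longleftrightarrow> dot d s u > t \<or> dot d s ?v > t" for s
    unfolding v(2) by linarith
  then have "{s \<in> ?S. \<bar>dot d s u\<bar> > t} = {s \<in> ?S. dot d s u > t} \<union> {s \<in> ?S. dot d s ?v > t}"
    by blast
  then have "card {s \<in> ?S. \<bar>dot d s u\<bar> > t} \<le> card {s \<in> ?S. dot d s u > t} + card {s \<in> ?S. dot d s ?v > t}"
    by (simp only: card_Un_le)
  then show ?thesis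
    using signed_sum_upper_tail[OF u t] signed_sum_upper_tail[OF v(1) t] by linarith
qed

section \<open>Measurability of the vector and matrix operations\<close>

lemma measurable_vec_component:
  assumes "f \<in> M \<rightarrow>\<^sub>M vec_space d" "i < d"
  shows "(\<lambda>x. f x i) \<in> borel_measurable M"
  using measurable_compose[OF assms(1)[unfolded vec_space_def] measurable_component_singleton[of i]] assms(2)
  by simp

lemma measurable_mat_component:
  assumes "f \<in> M \<rightarrow>\<^sub>M mat_space d" "i < d"
  shows "(\<lambda>x. f x i) \<in> M \<rightarrow>\<^sub>M vec_space d"
  using measurable_compose[OF assms(1)[unfolded mat_space_def] measurable_component_singleton[of i]] assms(2)
  by simp

lemma measurable_vec_spaceI:
  assumes "\<And>i. i < d \<Longrightarrow> (\<lambda>x. f x i) \<in> borel_measurable M"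
  shows "(\<lambda>x. \<lambda>i\<in>{..<d}. f x i) \<in> M \<rightarrow>\<^sub>M vec_space d"
  unfolding vec_space_def using assms by (intro measurable_restrict) auto

lemma measurable_mat_spaceI:
  assumes "\<And>i. i < d \<Longrightarrow> (\<lambda>x. f x i) \<in> M \<rightarrow>\<^sub>M vec_space d"
  shows "(\<lambda>x. \<lambda>i\<in>{..<d}. f x i) \<in> M \<rightarrow>\<^sub>M mat_space d"
  unfolding mat_space_def using assms by (intro measurable_restrict) auto

lemma measurable_dot [measurable (raw)]:
  assumes [measurable]: "f \<in> M \<rightarrow>\<^sub>M vec_space d" "g \<in> M \<rightarrow>\<^sub>M vec_space d"
  shows "(\<lambda>x. dot d (f x) (g x)) \<in> borel_measurable M"
proof -
  note [measurable (raw)] = assms[THEN measurable_vec_component]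
  show ?thesis unfolding dot_def by measurable
qed

lemma measurable_vnorm [measurable (raw)]:
  assumes [measurable]: "f \<in> M \<rightarrow>\<^sub>M vec_space d"
  shows "(\<lambda>x. vnorm d (f x)) \<in> borel_measurable M"
  unfolding vnorm_eq_sqrt_dot by measurable

lemma measurable_vscale [measurable (raw)]:
  assumes [measurable]: "f \<in> M \<rightarrow>\<^sub>M vec_space d" "c \<in> borel_measurable M"
  shows "(\<lambda>x. vscale d (c x) (f x)) \<in> M \<rightarrow>\<^sub>M vec_space d"
proof -
  note [measurable (raw)] = measurable_vec_component[OF assms(1)]
  show ?thesis unfolding vscale_def by (rule measurable_vec_spaceI) measurable
qed

lemma measurable_vdiff [measurable (raw)]:
  assumes [measurable]: "f \<in> M \<rightarrow>\<^sub>M vec_space d" "g \<in> M \<rightarrow>\<^sub>M vec_space d"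
  shows "(\<lambda>x. vdiff d (f x) (g x)) \<in> M \<rightarrow>\<^sub>M vec_space d"
proof -
  note [measurable (raw)] = assms[THEN measurable_vec_component]
  show ?thesis unfolding vdiff_def by (rule measurable_vec_spaceI) measurable
qed

lemma measurable_normalize_vec [measurable (raw)]:
  assumes [measurable]: "f \<in> M \<rightarrow>\<^sub>M vec_space d"
  shows "(\<lambda>x. normalize_vec d (f x)) \<in> M \<rightarrow>\<^sub>M vec_space d"
  unfolding normalize_vec_def by measurable

lemma measurable_mat_app [measurable (raw)]:
  assumes [measurable]: "U \<in> M \<rightarrow>\<^sub>M mat_space d" "f \<in> M \<rightarrow>\<^sub>M vec_space d"
  shows "(\<lambda>x. mat_app d (U x) (f x)) \<in> M \<rightarrow>\<^sub>M vec_space d"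
proof -
  note [measurable (raw)] = measurable_mat_component[OF assms(1)]
  show ?thesis unfolding mat_app_def by (rule measurable_vec_spaceI) measurable
qed

lemma measurable_mat_transp [measurable (raw)]:
  assumes [measurable]: "U \<in> M \<rightarrow>\<^sub>M mat_space d"
  shows "(\<lambda>x. mat_transp d (U x)) \<in> M \<rightarrow>\<^sub>M mat_space d"
  unfolding mat_transp_def
  by (intro measurable_mat_spaceI measurable_vec_spaceI
      measurable_vec_component[OF measurable_mat_component[OF assms]])

lemma measurable_mat_mul [measurable (raw)]:
  assumes [measurable]: "U \<in> M \<rightarrow>\<^sub>M mat_space d" "V \<in> M \<rightarrow>\<^sub>M mat_space d"
  shows "(\<lambda>x. mat_mul d (U x) (V x)) \<in> M \<rightarrow>\<^sub>M mat_space d"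
proof -
  note [measurable (raw)] = assms[THEN measurable_mat_component, THEN measurable_vec_component]
  show ?thesis
    unfolding mat_mul_def by (intro measurable_mat_spaceI measurable_vec_spaceI) measurable
qed

section \<open>Tail of a coordinate of a uniformly rotated vector\<close>

text \<open>Left invariance replaces \<open>U\<close> by \<open>R U\<close>, and the adjoint moves
  \<open>R\<close> from the random vector to the fixed one.\<close>

lemma uniform_rotation_tail_invariant:
  assumes \<mu>: "uniform_rotation d \<mu>" and R: "is_rotation d R" and a: "a \<in> space (vec_space d)"
    and b: "b \<in> space (vec_space d)"
  shows "measure \<mu> {U \<in> space \<mu>. \<bar>dot d (mat_app d (mat_transp d R) b) (mat_app d U a)\<bar> > r} =
    measure \<mu> {U \<in> space \<mu>. \<bar>dot d b (mat_app d U a)\<bar> > r}"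
proof -
  have sets [measurable_cong]: "sets \<mu> = sets (mat_space d)"
    and inv: "distr \<mu> (mat_space d) (mat_mul d R) = \<mu>"
    using \<mu> R by (auto simp: uniform_rotation_def)
  have space: "space \<mu> = space (mat_space d)" by (rule sets_eq_imp_space_eq) (rule sets)
  note [measurable] = a b
  have [measurable]: "R \<in> space (mat_space d)" using R by (simp add: is_rotation_def)
  have "measure \<mu> {U \<in> space \<mu>. \<bar>dot d b (mat_app d U a)\<bar> > r} =
      measure (distr \<mu> (mat_space d) (mat_mul d R)) {U \<in> space (mat_space d). \<bar>dot d b (mat_app d U a)\<bar> > r}"
    by (simp add: inv space)
  also have "\<dots> = measure \<mu> (mat_mul d R -` {U \<in> space (mat_space d). \<bar>dot d b (mat_app d U a)\<bar> > r} \<inter> space \<mu>)"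
    by (rule measure_distr) measurable
  also have "mat_mul d R -` {U \<in> space (mat_space d). \<bar>dot d b (mat_app d U a)\<bar> > r} \<inter> space \<mu> =
      {U \<in> space \<mu>. \<bar>dot d (mat_app d (mat_transp d R) b) (mat_app d U a)\<bar> > r}"
  proof -
    have "mat_mul d R U \<in> space (mat_space d)" if "U \<in> space \<mu>" for U
      using that by (rule measurable_space[rotated]) measurable
    moreover have "dot d b (mat_app d (mat_mul d R U) a) = dot d (mat_app d (mat_transp d R) b) (mat_app d U a)" for U
      unfolding mat_app_mat_mul by (metis dot_commute dot_mat_app_left)
    ultimately show ?thesis by auto
  qed
  finally show ?thesis ..
qed

text \<open>By invariance \<open>b\<close> may be replaced by its average over the vectors with entries
  \<open>\<plusminus>1/\<surd>d\<close>, and for a fixed matrix that average is the tail of a Rademacher sum.\<close>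

lemma uniform_rotation_tail:
  assumes \<mu>: "uniform_rotation d \<mu>" and d: "d > 0" and r: "r \<ge> 0"
    and a: "a \<in> space (vec_space d)" "dot d a a = 1"
    and b: "b \<in> space (vec_space d)" "dot d b b = 1"
  shows "measure \<mu> {U \<in> space \<mu>. \<bar>dot d b (mat_app d U a)\<bar> > r} \<le> 2 * exp (- r\<^sup>2 * d / 2)"
proof -
  have sets [measurable_cong]: "sets \<mu> = sets (mat_space d)" and rot: "AE U in \<mu>. is_rotation d U"
    and "prob_space \<mu>"
    using \<mu> by (auto simp: uniform_rotation_def)
  then interpret prob_space \<mu> by simp
  have space: "space \<mu> = space (mat_space d)" by (rule sets_eq_imp_space_eq) (rule sets)
  define F where "F c = {U \<in> space \<mu>. \<bar>dot d c (mat_app d U a)\<bar> > r}" for c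
  let ?S = "{..<d} \<rightarrow>\<^sub>E {-1, 1::real}"
  define c where "c s = (\<lambda>i\<in>{..<d}. (1 / sqrt d) * s i)" for s :: "nat \<Rightarrow> real"
  have fin: "finite ?S" by (simp add: finite_PiE)
  have cardS: "card ?S = 2 ^ d"
    by (simp add: card_PiE numeral_2_eq_2)
  note [measurable] = a(1)
  have cS: "c s \<in> space (vec_space d)" for s
    by (simp add: c_def space_vec_space)
  have F_sets [measurable]: "F (c s) \<in> sets \<mu>" for s
    unfolding F_def using cS[measurable] by measurable
  have dot_c: "dot d (c s) x = dot d s x / sqrt d" for s x
    unfolding c_def dot_restrict dot_scale_left by simp
  have unit: "dot d (c s) (c s) = 1" if "s \<in> ?S" for s
  proof -
    have "s i * s i = 1" if "i < d" for i
      using PiE_mem[OF \<open>s \<in> ?S\<close>, of i] that by auto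
    then have "dot d s s = d" by (simp add: dot_def)
    then show ?thesis
      using d dot_c[of s "c s"] dot_c[of s s] dot_commute[of d s "c s"] by simp
  qed
  \<comment> \<open>If \<open>c s\<close> and \<open>b\<close> are antipodal there may be no
    rotation between them, but then the events coincide, since they see only the absolute
    value.\<close>
  have F_eq: "measure \<mu> (F (c s)) = measure \<mu> (F b)" if s: "s \<in> ?S" for s
  proof (cases "\<forall>i<d. c s i = - b i")
    case True
    then have "dot d (c s) x = dot d (\<lambda>i. (- 1) * b i) x" for x
      by (intro dot_cong) auto
    then show ?thesis
      unfolding F_def dot_linear by simp
  next
    case False
    then obtain R where R: "is_rotation d R" "\<And>i. i < d \<Longrightarrow> mat_app d (mat_transp d R) b i = c s i"
      using rotation_between_unit_vectors[OF b(2) unit[OF s]] by metis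
    have "dot d (c s) x = dot d (mat_app d (mat_transp d R) b) x" for x
      using R(2) by (intro dot_cong) auto
    then show ?thesis
      using uniform_rotation_tail_invariant[OF \<mu> R(1) a(1) b(1)] by (simp add: F_def)
  qed
  \<comment> \<open>The order of averaging is exchanged: under the integral \<open>U\<close> is
    fixed, and what is counted are the sign vectors whose event contains \<open>U\<close>. Their
    number is bounded for almost every \<open>U\<close>, as \<open>mat_app d U a\<close> is then a
    unit vector.\<close>
  have "2 ^ d * measure \<mu> (F b) = (\<Sum>s\<in>?S. measure \<mu> (F (c s)))"
    by (simp add: F_eq cardS)
  also have "\<dots> = (\<integral>U. (\<Sum>s\<in>?S. indicator (F (c s)) U) \<partial>\<mu>)"
    by (subst Bochner_Integration.integral_sum)
      (auto simp: integrable_real_indicator emeasure_eq_measure)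
  also have "\<dots> \<le> (\<integral>U. 2 ^ d * (2 * exp (- r\<^sup>2 * d / 2)) \<partial>\<mu>)"
  proof (rule integral_mono_AE)
    show "AE U in \<mu>. (\<Sum>s\<in>?S. indicator (F (c s)) U) \<le> 2 ^ d * (2 * exp (- r\<^sup>2 * d / 2))"
      using rot
    proof eventually_elim
      case (elim U)
      have "dot d (mat_app d U a) (mat_app d U a) = 1"
        using elim a by (simp add: rotation_dot)
      note tail = signed_sum_tail[OF this, of "r * sqrt d"]
      have "U \<in> F (c s) \<longleftrightarrow> \<bar>dot d s (mat_app d U a)\<bar> > r * sqrt d" for s
        using elim d by (simp add: F_def space is_rotation_def dot_c abs_divide pos_less_divide_eq)
      then have "(\<Sum>s\<in>?S. indicator (F (c s)) U) =
          (\<Sum>s\<in>?S. indicator {s. \<bar>dot d s (mat_app d U a)\<bar> > r * sqrt d} s :: real)"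
        by (intro sum.cong) (auto simp: indicator_def)
      also have "\<dots> = card {s \<in> ?S. \<bar>dot d s (mat_app d U a)\<bar> > r * sqrt d}"
        using fin by (simp add: indicator_def sum.If_cases Int_def)
      finally show ?case
        using tail r by (simp add: power_mult_distrib)
    qed
  qed (auto simp: integrable_real_indicator emeasure_eq_measure)
  finally show ?thesis
    by (simp add: F_def prob_space)
qed

subsection \<open>Rotation invariance\<close>

definition vec_lborel :: "nat \<Rightarrow> (nat \<Rightarrow> real) measure" where
  "vec_lborel d = Pi\<^sub>M {..<d} (\<lambda>_. lborel)"

definition vadd :: "nat \<Rightarrow> (nat \<Rightarrow> real) \<Rightarrow> (nat \<Rightarrow> real) \<Rightarrow> nat \<Rightarrow> real" where
  "vadd d x y = (\<lambda>i\<in>{..<d}. x i + y i)"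

definition unit_ball :: "nat \<Rightarrow> (nat \<Rightarrow> real) set" where
  "unit_ball d = {x \<in> space (vec_space d). vnorm d x \<le> 1}"

lemma sets_vec_lborel [measurable_cong, simp]: "sets (vec_lborel d) = sets (vec_space d)"
  unfolding vec_lborel_def vec_space_def by (intro sets_PiM_cong) auto

lemma space_vec_lborel [simp]: "space (vec_lborel d) = space (vec_space d)"
  by (rule sets_eq_imp_space_eq) simp

lemma sigma_finite_vec_lborel: "sigma_finite_measure (vec_lborel d)"
proof -
  interpret product_sigma_finite "\<lambda>_. lborel :: real measure" by standard
  interpret finite_product_sigma_finite "\<lambda>_. lborel :: real measure" "{..<d}" by standard simp
  show ?thesis unfolding vec_lborel_def by (rule sigma_finite_measure_axioms)
qed

lemma emeasure_vec_lborel_box: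
  assumes "\<And>i. i < d \<Longrightarrow> A i \<in> sets borel"
  shows "emeasure (vec_lborel d) (Pi\<^sub>E {..<d} A) = (\<Prod>i<d. emeasure lborel (A i))"
proof -
  interpret product_sigma_finite "\<lambda>_. lborel :: real measure" by standard
  show ?thesis
    unfolding vec_lborel_def using assms by (intro emeasure_PiM) auto
qed

lemma mat_app_vdiff: "mat_app d U (vdiff d x y) = vdiff d (mat_app d U x) (mat_app d U y)"
  by (auto simp: mat_app_def vdiff_def dot_diff_right fun_eq_iff)

lemma mat_app_vadd: "mat_app d U (vadd d x y) = vadd d (mat_app d U x) (mat_app d U y)"
  by (auto simp: mat_app_def vadd_def dot_add_right fun_eq_iff)

lemma measurable_vadd [measurable (raw)]:
  assumes [measurable]: "f \<in> M \<rightarrow>\<^sub>M vec_space d" "g \<in> M \<rightarrow>\<^sub>M vec_space d"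
  shows "(\<lambda>x. vadd d (f x) (g x)) \<in> M \<rightarrow>\<^sub>M vec_space d"
proof -
  note [measurable (raw)] = assms[THEN measurable_vec_component]
  show ?thesis unfolding vadd_def by (rule measurable_vec_spaceI) measurable
qed

lemma unit_ball_sets [measurable]: "unit_ball d \<in> sets (vec_space d)"
  unfolding unit_ball_def by measurable

text \<open>A product measure is determined on boxes, and a translated box is a box with translated
  sides, so the one-dimensional invariance applies to each coordinate.\<close>

lemma vec_lborel_translation_invariant:
  assumes [measurable]: "t \<in> space (vec_space d)"
  shows "distr (vec_lborel d) (vec_space d) (\<lambda>x. vadd d x t) = vec_lborel d"
proof -
  interpret product_sigma_finite "\<lambda>_. lborel :: real measure" by standard
  have "distr (vec_lborel d) (vec_space d) (\<lambda>x. vadd d x t) = Pi\<^sub>M {..<d} (\<lambda>_. lborel)"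
  proof (rule PiM_eqI)
    fix A :: "nat \<Rightarrow> real set" assume A: "\<And>i. i \<in> {..<d} \<Longrightarrow> A i \<in> sets lborel"
    have PiE: "Pi\<^sub>E {..<d} A \<in> sets (vec_space d)"
      unfolding vec_space_def using A by (intro sets_PiM_I_finite) auto
    have "emeasure (distr (vec_lborel d) (vec_space d) (\<lambda>x. vadd d x t)) (Pi\<^sub>E {..<d} A) =
        emeasure (vec_lborel d) ((\<lambda>x. vadd d x t) -` Pi\<^sub>E {..<d} A \<inter> space (vec_lborel d))"
      using PiE by (intro emeasure_distr) measurable
    also have "(\<lambda>x. vadd d x t) -` Pi\<^sub>E {..<d} A \<inter> space (vec_lborel d) =
        (\<Pi>\<^sub>E i\<in>{..<d}. (+) (t i) -` A i)"
    proof -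
      have "vadd d x t \<in> Pi\<^sub>E {..<d} A \<longleftrightarrow> (\<forall>i<d. t i + x i \<in> A i)" for x
        by (simp add: PiE_iff vadd_def add.commute Ball_def)
      then show ?thesis
        by (simp add: set_eq_iff PiE_iff space_vec_space Ball_def)
    qed
    also have "emeasure (vec_lborel d) \<dots> = (\<Prod>i<d. emeasure lborel ((+) (t i) -` A i))"
      using A by (intro emeasure_vec_lborel_box measurable_sets_borel[of _ borel]) auto
    also have "\<dots> = (\<Prod>i<d. emeasure lborel (A i))"
    proof (intro prod.cong refl)
      fix i assume "i \<in> {..<d}"
      then have "emeasure (distr lborel borel ((+) (t i))) (A i) = emeasure lborel ((+) (t i) -` A i)"
        using A by (subst emeasure_distr) auto
      then show "emeasure lborel ((+) (t i) -` A i) = emeasure lborel (A i)"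
        by (simp add: lborel_distr_plus)
    qed
    finally show "emeasure (distr (vec_lborel d) (vec_space d) (\<lambda>x. vadd d x t)) (Pi\<^sub>E {..<d} A) =
        (\<Prod>i\<in>{..<d}. emeasure lborel (A i))" .
  qed (simp_all flip: vec_lborel_def)
  then show ?thesis by (simp add: vec_lborel_def)
qed

lemma nn_integral_vec_lborel_translate:
  assumes [measurable]: "t \<in> space (vec_space d)" "f \<in> borel_measurable (vec_space d)"
  shows "(\<integral>\<^sup>+x. f (vadd d x t) \<partial>vec_lborel d) = (\<integral>\<^sup>+x. f x \<partial>vec_lborel d)"
proof -
  have "(\<integral>\<^sup>+x. f x \<partial>vec_lborel d) = (\<integral>\<^sup>+x. f x \<partial>distr (vec_lborel d) (vec_space d) (\<lambda>x. vadd d x t))"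
    by (simp add: vec_lborel_translation_invariant assms(1))
  also have "\<dots> = (\<integral>\<^sup>+x. f (vadd d x t) \<partial>vec_lborel d)"
    by (rule nn_integral_distr) measurable
  finally show ?thesis ..
qed

lemma emeasure_unit_ball_finite: "emeasure (vec_lborel d) (unit_ball d) < \<infinity>"
proof -
  have "x i \<in> {-1..1}" if "x \<in> unit_ball d" "i < d" for x i
  proof -
    have "(x i)\<^sup>2 \<le> dot d x x"
      unfolding dot_def using that(2)
      by (intro order_trans[OF _ member_le_sum[of i]]) (auto simp: power2_eq_square)
    also have "\<dots> \<le> 1"
      using that(1) by (simp add: unit_ball_def vnorm_eq_sqrt_dot)
    finally show ?thesis
      by (auto simp: abs_le_iff power2_le_iff_abs_le[of 1, simplified] abs_square_le_1)
  qed
  then have "unit_ball d \<subseteq> (\<Pi>\<^sub>E i\<in>{..<d}. {-1..1})"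
    by (intro subsetI PiE_I) (auto simp: unit_ball_def space_vec_space extensional_def)
  then have "emeasure (vec_lborel d) (unit_ball d) \<le> emeasure (vec_lborel d) (\<Pi>\<^sub>E i\<in>{..<d}. {-1..1})"
    by (rule emeasure_mono) (auto simp: vec_space_def intro!: sets_PiM_I_finite)
  also have "\<dots> = 2 ^ d"
    by (subst emeasure_vec_lborel_box) auto
  also have "\<dots> < \<infinity>"
    by (simp add: power_less_top_ennreal)
  finally show ?thesis .
qed

lemma emeasure_unit_ball_pos: "emeasure (vec_lborel d) (unit_ball d) > 0"
proof -
  \<comment> \<open>With this side length \<open>d\<close> squares sum to at most
    \<open>d / (d + 1) \<le> 1\<close>, so the box lies in the ball; the added 1 keeps the quotient
    positive for \<open>d = 0\<close>.\<close>
  let ?h = "1 / (real d + 1)"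
  have "x \<in> unit_ball d" if x: "x \<in> (\<Pi>\<^sub>E i\<in>{..<d}. {0..?h})" for x
  proof -
    have "x i * x i \<le> ?h" if "i < d" for i
    proof -
      have "0 \<le> x i" "x i \<le> ?h" using PiE_mem[OF x, of i] that by auto
      moreover have "?h \<le> 1" by simp
      ultimately have "x i * x i \<le> 1 * ?h" by (intro mult_mono) linarith+
      then show ?thesis by simp
    qed
    then have "dot d x x \<le> (\<Sum>i<d. ?h)"
      unfolding dot_def by (intro sum_mono) auto
    also have "\<dots> \<le> 1" by simp
    finally show ?thesis
      using x by (auto simp: unit_ball_def space_vec_space vnorm_eq_sqrt_dot PiE_iff)
  qed
  then have "emeasure (vec_lborel d) (\<Pi>\<^sub>E i\<in>{..<d}. {0..?h}) \<le> emeasure (vec_lborel d) (unit_ball d)"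
    by (intro emeasure_mono) auto
  moreover have "emeasure (vec_lborel d) (\<Pi>\<^sub>E i\<in>{..<d}. {0..?h}) = ennreal ?h ^ d"
    by (subst emeasure_vec_lborel_box) auto
  moreover have "ennreal ?h ^ d > 0"
    by (subst ennreal_power) auto
  ultimately show ?thesis by (metis less_le_trans)
qed

text \<open>The pushforward of Lebesgue measure under a rotation is translation invariant, hence a
  multiple of Lebesgue measure; the unit ball shows that the factor is 1.\<close>

lemma vec_lborel_rotation_invariant:
  assumes U: "is_rotation d U"
  shows "distr (vec_lborel d) (vec_space d) (mat_app d U) = vec_lborel d"
proof (rule measure_eqI)
  fix A assume "A \<in> sets (distr (vec_lborel d) (vec_space d) (mat_app d U))"
  then have [measurable]: "A \<in> sets (vec_space d)" by simp
  have U_mem [measurable]: "U \<in> space (mat_space d)" using U by (simp add: is_rotation_def)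
  let ?L = "vec_lborel d" and ?B = "unit_ball d"
  let ?UT = "mat_app d (mat_transp d U)"
  interpret L: sigma_finite_measure ?L by (rule sigma_finite_vec_lborel)
  interpret LL: pair_sigma_finite ?L ?L ..
  have UT_mem: "?UT x \<in> space (vec_space d)" and Ux_mem: "mat_app d U x \<in> space (vec_space d)" for x
    by (simp_all add: space_vec_space)
  \<comment> \<open>Translation invariance of the pushforward: a shift by \<open>x\<close> after
    \<open>U\<close> is a shift by the preimage \<open>?UT x\<close> before it.\<close>
  have 1: "(\<integral>\<^sup>+y. indicator A (mat_app d U y) \<partial>?L) =
      (\<integral>\<^sup>+y. indicator A (vadd d (mat_app d U y) x) \<partial>?L)" if x: "x \<in> space (vec_space d)" for x
  proof -
    have "(\<integral>\<^sup>+y. indicator A (mat_app d U (vadd d y (?UT x))) \<partial>?L) = (\<integral>\<^sup>+y. indicator A (mat_app d U y) \<partial>?L)"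
      using UT_mem by (intro nn_integral_vec_lborel_translate) measurable
    moreover have "mat_app d U (?UT x) = x"
      using x by (simp add: rotation_mat_app_transp[OF U] space_vec_space)
    ultimately show ?thesis by (simp add: mat_app_vadd)
  qed
  have 2: "(\<integral>\<^sup>+x. indicator ?B x * indicator A (vadd d (mat_app d U y) x) \<partial>?L) =
      (\<integral>\<^sup>+x. indicator ?B (vdiff d x (mat_app d U y)) * indicator A x \<partial>?L :: ennreal)" for y
  proof -
    note [measurable] = Ux_mem[of y]
    have "(\<integral>\<^sup>+x. indicator ?B (vdiff d (vadd d x (mat_app d U y)) (mat_app d U y)) *
        indicator A (vadd d x (mat_app d U y)) \<partial>?L) =
      (\<integral>\<^sup>+x. indicator ?B (vdiff d x (mat_app d U y)) * indicator A x \<partial>?L :: ennreal)"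
      using Ux_mem by (intro nn_integral_vec_lborel_translate) measurable
    moreover have "vdiff d (vadd d x z) z = x" if "x \<in> space (vec_space d)" for x z
      using that by (auto simp: vdiff_def vadd_def space_vec_space extensional_def)
    moreover have "vadd d x z = vadd d z x" for x z
      by (auto simp: vadd_def)
    ultimately show ?thesis
      by (simp cong: nn_integral_cong_simp)
  qed
  \<comment> \<open>Only here the orthogonality of \<open>U\<close> enters through the shape of the
    set: the unit ball is its own image under \<open>U\<close> and under negation, so the points
    \<open>y\<close> in question form a translate of it.\<close>
  have 3: "(\<integral>\<^sup>+y. indicator ?B (vdiff d x (mat_app d U y)) \<partial>?L) = emeasure ?L ?B"
    if x: "x \<in> space (vec_space d)" for x
  proof -
    note [measurable] = UT_mem[of x]
    have "vnorm d (vdiff d x (mat_app d U y)) = vnorm d (vdiff d y (?UT x))"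
      if "y \<in> space (vec_space d)" for y
    proof -
      have "mat_app d U (vdiff d y (?UT x)) = vdiff d (mat_app d U y) (mat_app d U (?UT x))"
        by (rule mat_app_vdiff)
      also have "mat_app d U (?UT x) = x"
        using x by (simp add: rotation_mat_app_transp[OF U] space_vec_space)
      finally have "vnorm d (vdiff d y (?UT x)) = vnorm d (vdiff d (mat_app d U y) x)"
        using rotation_vnorm[OF U] by metis
      also have "\<dots> = vnorm d (vdiff d x (mat_app d U y))"
        unfolding vnorm_eq_sqrt_dot dot_def
        by (intro arg_cong[where f=sqrt] sum.cong) (auto simp: vdiff_def algebra_simps)
      finally show ?thesis ..
    qed
    then have "(\<integral>\<^sup>+y. indicator ?B (vdiff d x (mat_app d U y)) \<partial>?L) =
        (\<integral>\<^sup>+y. indicator ?B (vdiff d y (?UT x)) \<partial>?L)"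
      by (intro nn_integral_cong)
        (auto simp: indicator_def unit_ball_def space_vec_space vdiff_def)
    also have "\<dots> = (\<integral>\<^sup>+y. indicator ?B (vdiff d (vadd d y (?UT x)) (?UT x)) \<partial>?L)"
      using UT_mem by (intro nn_integral_vec_lborel_translate[symmetric]) measurable
    also have "\<dots> = (\<integral>\<^sup>+y. indicator ?B y \<partial>?L)"
    proof (intro nn_integral_cong)
      fix y assume "y \<in> space ?L"
      then have "vdiff d (vadd d y (?UT x)) (?UT x) = y"
        by (auto simp: vdiff_def vadd_def space_vec_space extensional_def)
      then show "(indicator ?B (vdiff d (vadd d y (?UT x)) (?UT x)) :: ennreal) = indicator ?B y"
        by simp
    qed
    finally show ?thesis by simp
  qed
  \<comment> \<open>Both sides are readings of one double integral, of the indicator of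
    \<open>x\<close> in the ball and \<open>U y + x\<close> in \<open>A\<close>. Integrating over
    \<open>y\<close> first gives the pushforward of \<open>A\<close>; shifting \<open>x\<close> by
    \<open>U y\<close> and then integrating over \<open>y\<close> gives the Lebesgue measure of
    \<open>A\<close>. The factor is cancelled at the end because the volume of the ball is positive
    and finite.\<close>
  have "emeasure ?L ?B * emeasure (distr ?L (vec_space d) (mat_app d U)) A =
      emeasure ?L ?B * (\<integral>\<^sup>+y. indicator A (mat_app d U y) \<partial>?L)"
  proof -
    have "emeasure (distr ?L (vec_space d) (mat_app d U)) A =
        (\<integral>\<^sup>+y. indicator A y \<partial>distr ?L (vec_space d) (mat_app d U))"
      by simp
    also have "\<dots> = (\<integral>\<^sup>+y. indicator A (mat_app d U y) \<partial>?L)"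
      by (rule nn_integral_distr) measurable
    finally show ?thesis by simp
  qed
  also have "\<dots> = (\<integral>\<^sup>+x. indicator ?B x * (\<integral>\<^sup>+y. indicator A (mat_app d U y) \<partial>?L) \<partial>?L)"
    by (simp add: nn_integral_multc)
  also have "\<dots> = (\<integral>\<^sup>+x. (\<integral>\<^sup>+y. indicator ?B x * indicator A (vadd d (mat_app d U y) x) \<partial>?L) \<partial>?L)"
    by (intro nn_integral_cong) (simp add: 1 nn_integral_cmult)
  also have "\<dots> = (\<integral>\<^sup>+y. (\<integral>\<^sup>+x. indicator ?B x * indicator A (vadd d (mat_app d U y) x) \<partial>?L) \<partial>?L)"
    by (rule LL.Fubini'[symmetric]) measurable
  also have "\<dots> = (\<integral>\<^sup>+y. (\<integral>\<^sup>+x. indicator ?B (vdiff d x (mat_app d U y)) * indicator A x \<partial>?L) \<partial>?L)"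
    by (simp only: 2)
  also have "\<dots> = (\<integral>\<^sup>+x. (\<integral>\<^sup>+y. indicator ?B (vdiff d x (mat_app d U y)) * indicator A x \<partial>?L) \<partial>?L)"
    by (rule LL.Fubini') measurable
  also have "\<dots> = (\<integral>\<^sup>+x. emeasure ?L ?B * indicator A x \<partial>?L)"
    by (intro nn_integral_cong) (simp add: 3 nn_integral_multc)
  also have "\<dots> = emeasure ?L ?B * emeasure ?L A"
    by (simp add: nn_integral_cmult)
  finally show "emeasure (distr ?L (vec_space d) (mat_app d U)) A = emeasure ?L A"
    using emeasure_unit_ball_pos[of d] emeasure_unit_ball_finite[of d]
    by (auto simp: ennreal_mult_cancel_left)
qed simp

text \<open>The product of the one-dimensional densities depends on \<open>x\<close> only through
  \<open>dot d x x\<close>; in this form rotation invariance reduces to that of Lebesgue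
  measure.\<close>

lemma std_gauss_eq_density:
  "std_gauss d = density (vec_lborel d)
     (\<lambda>x. ennreal ((1 / sqrt (2 * pi)) ^ d * exp (- dot d x x / 2)))"
proof -
  interpret product_sigma_finite "\<lambda>_. lborel :: real measure" by standard
  let ?N = "density lborel (\<lambda>t. ennreal (std_normal_density t))"
  interpret N: product_prob_space "\<lambda>_. ?N"
    by (intro product_prob_spaceI prob_space_normal_density) simp
  let ?g = "\<lambda>x. ennreal ((1 / sqrt (2 * pi)) ^ d * exp (- dot d x x / 2))"
  have g: "?g x = (\<Prod>i<d. ennreal (std_normal_density (x i)))" for x
  proof -
    have "(\<Prod>i<d. std_normal_density (x i)) = (1 / sqrt (2 * pi)) ^ d * exp (\<Sum>i<d. - (x i)\<^sup>2 / 2)"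
      unfolding std_normal_density_def prod.distrib exp_sum[OF finite_lessThan] by simp
    also have "(\<Sum>i<d. - (x i)\<^sup>2 / 2) = - dot d x x / 2"
      by (simp add: dot_def power2_eq_square sum_negf sum_divide_distrib)
    finally show ?thesis
      by (simp add: prod_ennreal)
  qed
  have "density (vec_lborel d) ?g = Pi\<^sub>M {..<d} (\<lambda>_. ?N)"
  proof (rule N.PiM_eqI)
    show "sets (density (vec_lborel d) ?g) = sets (Pi\<^sub>M {..<d} (\<lambda>_. ?N))"
      by (auto simp: vec_space_def intro!: sets_PiM_cong)
    fix A :: "nat \<Rightarrow> real set" assume A: "\<And>i. i \<in> {..<d} \<Longrightarrow> A i \<in> sets ?N"
    have PiE: "Pi\<^sub>E {..<d} A \<in> sets (vec_space d)"
      unfolding vec_space_def using A by (intro sets_PiM_I_finite) auto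
    have "emeasure (density (vec_lborel d) ?g) (Pi\<^sub>E {..<d} A) =
        (\<integral>\<^sup>+x. ?g x * indicator (Pi\<^sub>E {..<d} A) x \<partial>vec_lborel d)"
      using PiE by (intro emeasure_density) measurable
    also have "\<dots> = (\<integral>\<^sup>+x. (\<Prod>i<d. ennreal (std_normal_density (x i)) * indicator (A i) (x i)) \<partial>vec_lborel d)"
      unfolding g prod.distrib
    proof (intro nn_integral_cong)
      fix x assume "x \<in> space (vec_lborel d)"
      then have "indicator (Pi\<^sub>E {..<d} A) x = (\<Prod>i<d. indicator (A i) (x i) :: ennreal)"
        by (auto simp: indicator_def space_vec_space PiE_iff prod_eq_1_iff Pi_iff split: if_splits)
      then show "(\<Prod>i<d. ennreal (std_normal_density (x i))) * indicator (Pi\<^sub>E {..<d} A) x =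
          (\<Prod>i<d. ennreal (std_normal_density (x i))) * (\<Prod>i<d. indicator (A i) (x i))"
        by simp
    qed
    also have "\<dots> = (\<Prod>i<d. \<integral>\<^sup>+t. ennreal (std_normal_density t) * indicator (A i) t \<partial>lborel)"
      unfolding vec_lborel_def using A by (intro product_nn_integral_prod) auto
    also have "\<dots> = (\<Prod>i<d. emeasure ?N (A i))"
      using A by (intro prod.cong) (auto simp: emeasure_density)
    finally show "emeasure (density (vec_lborel d) ?g) (Pi\<^sub>E {..<d} A) = (\<Prod>i\<in>{..<d}. emeasure ?N (A i))" .
  qed simp
  then show ?thesis by (simp add: std_gauss_def)
qed

lemma sets_std_gauss [measurable_cong, simp]: "sets (std_gauss d) = sets (vec_space d)"
  by (simp add: std_gauss_eq_density)

lemma prob_space_std_gauss: "prob_space (std_gauss d)"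
  unfolding std_gauss_def by (intro prob_space_PiM prob_space_normal_density) simp

lemma std_gauss_rotation_invariant:
  assumes U: "is_rotation d U"
  shows "distr (std_gauss d) (vec_space d) (mat_app d U) = std_gauss d"
proof -
  have [measurable]: "U \<in> space (mat_space d)" using U by (simp add: is_rotation_def)
  let ?g = "\<lambda>x. ennreal ((1 / sqrt (2 * pi)) ^ d * exp (- dot d x x / 2))"
  \<comment> \<open>The density is radial, so it may be composed with \<open>U\<close>; only a
    density of that form can be moved outside the pushforward.\<close>
  have "distr (std_gauss d) (vec_space d) (mat_app d U) =
      distr (density (vec_lborel d) (\<lambda>x. ?g (mat_app d U x))) (vec_space d) (mat_app d U)"
    by (simp add: std_gauss_eq_density rotation_dot[OF U])
  also have "\<dots> = density (distr (vec_lborel d) (vec_space d) (mat_app d U)) ?g"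
    by (rule density_distr[symmetric]) measurable
  finally show ?thesis
    by (simp add: vec_lborel_rotation_invariant[OF U] std_gauss_eq_density)
qed

subsection \<open>The uniform distribution on the sphere\<close>

lemma vnorm_vscale: "vnorm d (vscale d c x) = \<bar>c\<bar> * vnorm d x"
  by (simp add: vnorm_eq_sqrt_dot vscale_def dot_scale_left dot_scale_right real_sqrt_mult)

lemma vnorm_normalize_vec: "vnorm d x \<noteq> 0 \<Longrightarrow> vnorm d (normalize_vec d x) = 1"
  using vnorm_nonneg[of d x] by (simp add: normalize_vec_def vnorm_vscale)

lemma uniform_sphere_eq:
  "uniform_sphere d = distr (uniform_measure (vec_lborel d) (unit_ball d)) (vec_space d) (normalize_vec d)"
  by (simp add: uniform_sphere_def vec_lborel_def unit_ball_def)

lemma sets_uniform_sphere [measurable_cong, simp]: "sets (uniform_sphere d) = sets (vec_space d)"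
  by (simp add: uniform_sphere_eq)

lemma prob_space_uniform_sphere: "prob_space (uniform_sphere d)"
proof -
  interpret prob_space "uniform_measure (vec_lborel d) (unit_ball d)"
    using emeasure_unit_ball_pos[of d] emeasure_unit_ball_finite[of d]
    by (intro prob_space_uniform_measure) auto
  show ?thesis
    unfolding uniform_sphere_eq by (rule prob_space_distr) measurable
qed

text \<open>\<open>normalize_vec\<close> fixes the zero vector, so the claim amounts to the origin
  being a null set. This holds for \<open>d > 0\<close>; in dimension 0 the origin is the whole
  space and has measure 1.\<close>

lemma AE_uniform_sphere:
  assumes "d > 0"
  shows "AE v in uniform_sphere d. vnorm d v = 1"
proof -
  have "(\<Pi>\<^sub>E i\<in>{..<d}. {0}) \<in> null_sets (vec_lborel d)"
  proof (rule null_setsI)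
    show "emeasure (vec_lborel d) (\<Pi>\<^sub>E i\<in>{..<d}. {0}) = 0"
      using assms by (subst emeasure_vec_lborel_box) auto
    show "(\<Pi>\<^sub>E i\<in>{..<d}. {0}) \<in> sets (vec_lborel d)"
      unfolding sets_vec_lborel vec_space_def by (intro sets_PiM_I_finite) auto
  qed
  then have "AE x in vec_lborel d. x \<notin> (\<Pi>\<^sub>E i\<in>{..<d}. {0})"
    by (rule AE_not_in)
  then have "AE x in vec_lborel d. vnorm d x \<noteq> 0"
    using AE_space
  proof eventually_elim
    case (elim x)
    have "x \<in> (\<Pi>\<^sub>E i\<in>{..<d}. {0})" if "\<forall>i<d. x i = 0"
      using that elim(2) by (intro PiE_I) (auto simp: space_vec_space extensional_def)
    with elim(1) show ?case
      by (auto simp: vnorm_eq_sqrt_dot dot_self_eq_0_iff)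
  qed
  then have "AE x in vec_lborel d. x \<in> unit_ball d \<longrightarrow> vnorm d (normalize_vec d x) = 1"
    by eventually_elim (simp add: vnorm_normalize_vec)
  then have "AE x in uniform_measure (vec_lborel d) (unit_ball d). vnorm d (normalize_vec d x) = 1"
    by (rule AE_uniform_measureI[rotated]) simp
  then show ?thesis
    unfolding uniform_sphere_eq by (subst AE_distr_iff) measurable
qed

subsection \<open>The sampling model\<close>

lemma sets_P_model [measurable_cong, simp]: "sets (P_model d \<beta> E) = sets (vec_space d \<Otimes>\<^sub>M borel)"
  by (simp add: P_model_def)

lemma sets_R_star [measurable_cong, simp]: "sets (R_star \<rho> E) = sets borel"
  by (simp add: R_star_def)

lemma space_mem_prob_algebraI:
  "prob_space M \<Longrightarrow> sets M = sets N \<Longrightarrow> M \<in> space (prob_algebra N)"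
  by (simp add: space_prob_algebra)

lemma prob_space_P_model:
  assumes E: "real_distribution E" and [measurable]: "\<beta> \<in> space (vec_space d)"
  shows "prob_space (P_model d \<beta> E)"
proof -
  interpret E: real_distribution E by fact
  interpret prob_space "std_gauss d \<Otimes>\<^sub>M E"
    by (intro prob_space_pair prob_space_std_gauss E.prob_space_axioms)
  show ?thesis
    unfolding P_model_def by (rule prob_space_distr) measurable
qed

lemma prob_space_R_star:
  assumes E: "real_distribution E" and "\<rho> > 0"
  shows "prob_space (R_star \<rho> E)"
proof -
  interpret E: real_distribution E by fact
  interpret prob_space "density lborel (\<lambda>t. ennreal (normal_density 0 \<rho> t)) \<Otimes>\<^sub>M E"
    using assms by (intro prob_space_pair prob_space_normal_density E.prob_space_axioms)
  show ?thesis
    unfolding R_star_def by (rule prob_space_distr) measurable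
qed

definition rotate_sample :: "nat \<Rightarrow> (nat \<Rightarrow> nat \<Rightarrow> real) \<Rightarrow> (nat \<Rightarrow> real) \<times> real \<Rightarrow> (nat \<Rightarrow> real) \<times> real"
  where "rotate_sample d U p = (mat_app d U (fst p), snd p)"

lemma measurable_rotate_sample [measurable (raw)]:
  assumes [measurable]: "U \<in> M \<rightarrow>\<^sub>M mat_space d" "f \<in> M \<rightarrow>\<^sub>M vec_space d \<Otimes>\<^sub>M borel"
  shows "(\<lambda>x. rotate_sample d (U x) (f x)) \<in> M \<rightarrow>\<^sub>M vec_space d \<Otimes>\<^sub>M borel"
  unfolding rotate_sample_def by measurable

text \<open>Stated for a general second factor because it serves twice: with
  \<open>R_star \<rho> E\<close> it is the invariance of the null data, and with the noise law
  \<open>E\<close> it yields the effect of a rotation on \<open>P_model\<close>.\<close>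

lemma rotate_sample_gauss_pair:
  assumes U: "is_rotation d U" and N: "prob_space N" "sets N = sets borel"
  shows "distr (std_gauss d \<Otimes>\<^sub>M N) (vec_space d \<Otimes>\<^sub>M borel) (rotate_sample d U) = std_gauss d \<Otimes>\<^sub>M N"
proof -
  have [measurable]: "U \<in> space (mat_space d)" using U by (simp add: is_rotation_def)
  note [measurable_cong] = N(2)
  interpret N: prob_space N by fact
  have id: "distr N borel (\<lambda>x. x) = N" using N(2) by (intro distr_id2) simp
  have "distr (std_gauss d) (vec_space d) (mat_app d U) \<Otimes>\<^sub>M distr N borel (\<lambda>x. x) =
      distr (std_gauss d \<Otimes>\<^sub>M N) (vec_space d \<Otimes>\<^sub>M borel) (\<lambda>(x, y). (mat_app d U x, y))"
    by (rule pair_measure_distr) (simp_all add: id N.sigma_finite_measure_axioms N(2) measurable_ident_sets)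
  then show ?thesis
    by (simp add: std_gauss_rotation_invariant[OF U] id rotate_sample_def case_prod_unfold[abs_def]
        cong: distr_cong)
qed

text \<open>The response is unchanged since \<open><x, \<beta>> = <U x, U \<beta>>\<close>, while
  \<open>U x\<close> is again standard Gaussian and independent of the noise. Hence rotating the
  covariates rotates the regression vector.\<close>

lemma rotate_sample_P_model:
  assumes U: "is_rotation d U" and E: "real_distribution E" and [measurable]: "\<beta> \<in> space (vec_space d)"
  shows "distr (P_model d \<beta> E) (vec_space d \<Otimes>\<^sub>M borel) (rotate_sample d U) = P_model d (mat_app d U \<beta>) E"
proof -
  interpret E: real_distribution E by fact
  have [measurable]: "U \<in> space (mat_space d)" using U by (simp add: is_rotation_def)
  have "mat_app d U \<beta> \<in> space (vec_space d)" by (simp add: space_vec_space)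
  note [measurable] = this
  let ?VB = "vec_space d \<Otimes>\<^sub>M borel :: ((nat \<Rightarrow> real) \<times> real) measure"
  have "distr (P_model d \<beta> E) ?VB (rotate_sample d U) =
      distr (std_gauss d \<Otimes>\<^sub>M E) ?VB (rotate_sample d U \<circ> (\<lambda>(x, z). (x, dot d x \<beta> + z)))"
    unfolding P_model_def by (rule distr_distr) measurable
  also have "rotate_sample d U \<circ> (\<lambda>(x, z). (x, dot d x \<beta> + z)) =
      (\<lambda>(x, z). (x, dot d x (mat_app d U \<beta>) + z)) \<circ> rotate_sample d U"
    by (auto simp: rotate_sample_def rotation_dot[OF U])
  also have "distr (std_gauss d \<Otimes>\<^sub>M E) ?VB \<dots> =
      distr (distr (std_gauss d \<Otimes>\<^sub>M E) ?VB (rotate_sample d U)) ?VB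
        (\<lambda>(x, z). (x, dot d x (mat_app d U \<beta>) + z))"
    by (rule distr_distr[symmetric]) measurable
  finally show ?thesis
    by (simp add: rotate_sample_gauss_pair[OF U E.prob_space_axioms] P_model_def)
qed

lemma sets_iid: "sets D = sets D' \<Longrightarrow> sets (iid n D) = sets (iid n D')"
  unfolding iid_def by (intro sets_PiM_cong) auto

lemma sets_iid_sample_space:
  "sets D = sets (vec_space d \<Otimes>\<^sub>M borel) \<Longrightarrow> sets (iid n D) = sets (sample_space d n)"
  unfolding sample_space_def by (rule sets_iid)

lemma prob_space_iid: "prob_space D \<Longrightarrow> prob_space (iid n D)"
  unfolding iid_def by (rule prob_space_PiM)

lemma distr_iid:
  assumes D: "prob_space D" and f: "f \<in> D \<rightarrow>\<^sub>M D'"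
  shows "distr (iid n D) (iid n D') (\<lambda>S. \<lambda>i\<in>{..<n}. f (S i)) = iid n (distr D D' f)"
proof -
  interpret D: prob_space D by fact
  \<comment> \<open>As a target \<open>D'\<close> matters only through its measurable sets. It is
    exchanged for \<open>distr D D' f\<close>, which has the same sets and is a probability measure,
    as the rule for products of pushforwards requires.\<close>
  have "distr (iid n D) (iid n D') (\<lambda>S. \<lambda>i\<in>{..<n}. f (S i)) =
      distr (iid n D) (iid n (distr D D' f)) (compose {..<n} f)"
    by (intro distr_cong sets_iid) (simp_all add: compose_def)
  also have "\<dots> = iid n (distr D (distr D D' f) f)"
    unfolding iid_def using f
    by (intro distr_PiM_finite_prob_space' D D.prob_space_distr) (auto cong: measurable_cong_sets)
  also have "distr D (distr D D' f) f = distr D D' f"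
    by (intro distr_cong) simp_all
  finally show ?thesis .
qed

lemma measurable_sample_component:
  assumes "S \<in> M \<rightarrow>\<^sub>M sample_space d n" "i < n"
  shows "(\<lambda>x. S x i) \<in> M \<rightarrow>\<^sub>M vec_space d \<Otimes>\<^sub>M borel"
  using measurable_compose[OF assms(1)[unfolded sample_space_def iid_def] measurable_component_singleton[of i]]
    assms(2) by simp

lemma measurable_sample_spaceI:
  assumes "\<And>i. i < n \<Longrightarrow> (\<lambda>x. f x i) \<in> M \<rightarrow>\<^sub>M vec_space d \<Otimes>\<^sub>M borel"
  shows "(\<lambda>x. \<lambda>i\<in>{..<n}. f x i) \<in> M \<rightarrow>\<^sub>M sample_space d n"
  unfolding sample_space_def iid_def using assms by (intro measurable_restrict) auto

lemma measurable_rotate_samples [measurable (raw)]: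
  assumes [measurable]: "U \<in> M \<rightarrow>\<^sub>M mat_space d" "S \<in> M \<rightarrow>\<^sub>M sample_space d n"
  shows "(\<lambda>x. rotate_samples d n (U x) (S x)) \<in> M \<rightarrow>\<^sub>M sample_space d n"
proof -
  note [measurable (raw)] = measurable_sample_component[OF assms(2)]
  show ?thesis
    unfolding rotate_samples_def by (rule measurable_sample_spaceI) measurable
qed

lemma distr_rotate_samples:
  assumes U: "is_rotation d U" and D: "prob_space D" "sets D = sets (vec_space d \<Otimes>\<^sub>M borel)"
  shows "distr (iid n D) (sample_space d n) (rotate_samples d n U) =
    iid n (distr D (vec_space d \<Otimes>\<^sub>M borel) (rotate_sample d U))"
proof -
  have [measurable]: "U \<in> space (mat_space d)" using U by (simp add: is_rotation_def)
  have "rotate_samples d n U = (\<lambda>S. \<lambda>i\<in>{..<n}. rotate_sample d U (S i))"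
    by (auto simp: rotate_samples_def rotate_sample_def)
  moreover have "rotate_sample d U \<in> D \<rightarrow>\<^sub>M vec_space d \<Otimes>\<^sub>M borel"
    using D(2)[measurable_cong] by measurable
  ultimately show ?thesis
    unfolding sample_space_def using distr_iid[OF D(1)] by metis
qed

text \<open>This makes the mixture over the hidden direction a composition of kernels. The parameter
  is moved out of the measure: the samples are the image of a law free of \<open>\<beta>\<close>
  under a map that is jointly measurable in \<open>\<beta>\<close> and the raw data.\<close>

lemma measurable_iid_P_model:
  assumes E: "real_distribution E"
  shows "(\<lambda>\<beta>. iid n (P_model d \<beta> E)) \<in> vec_space d \<rightarrow>\<^sub>M prob_algebra (sample_space d n)"
proof -
  interpret E: real_distribution E by fact
  let ?D = "std_gauss d \<Otimes>\<^sub>M E"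
  have D: "prob_space ?D"
    by (intro prob_space_pair prob_space_std_gauss E.prob_space_axioms)
  have sets_D: "sets ?D = sets (vec_space d \<Otimes>\<^sub>M borel)"
    by (intro sets_pair_measure_cong) simp_all
  have eq: "iid n (P_model d \<beta> E) = distr (iid n ?D) (sample_space d n)
      (\<lambda>S. \<lambda>i\<in>{..<n}. case S i of (x, z) \<Rightarrow> (x, dot d x \<beta> + z))"
    if [measurable]: "\<beta> \<in> space (vec_space d)" for \<beta>
    unfolding P_model_def sample_space_def by (rule distr_iid[OF D, symmetric]) measurable
  have comp [measurable (raw)]: "i < n \<Longrightarrow> (\<lambda>p. snd p i) \<in> vec_space d \<Otimes>\<^sub>M sample_space d n \<rightarrow>\<^sub>M vec_space d \<Otimes>\<^sub>M borel" for i
    by (rule measurable_sample_component[where n=n]) simp_all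
  have "(\<lambda>p. \<lambda>i\<in>{..<n}. case snd p i of (x, z) \<Rightarrow> (x, dot d x (fst p) + z))
      \<in> vec_space d \<Otimes>\<^sub>M sample_space d n \<rightarrow>\<^sub>M sample_space d n"
    by (rule measurable_sample_spaceI) measurable
  then have "(\<lambda>\<beta>. distr (iid n ?D) (sample_space d n)
      (\<lambda>S. \<lambda>i\<in>{..<n}. case S i of (x, z) \<Rightarrow> (x, dot d x \<beta> + z)))
      \<in> vec_space d \<rightarrow>\<^sub>M prob_algebra (sample_space d n)"
    by (intro measurable_distr_prob_space2[where M="sample_space d n"] measurable_const space_mem_prob_algebraI
        prob_space_iid D sets_iid_sample_space sets_D)
      (simp add: case_prod_unfold)
  then show ?thesis
    by (rule measurable_cong[THEN iffD2, rotated]) (rule eq)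
qed

subsection \<open>The test\<close>

definition verdict :: "nat \<Rightarrow> (nat \<Rightarrow> nat \<Rightarrow> real) \<Rightarrow> (nat \<Rightarrow> real) \<Rightarrow> (nat \<Rightarrow> real) \<Rightarrow> hypothesis" where
  "verdict d U b w =
     (if \<bar>dot d (normalize_vec d b) (normalize_vec d (mat_app d (mat_transp d U) w))\<bar> > 1 / 9
      then Alternate else Null)"

lemma measurable_verdict [measurable (raw)]:
  assumes [measurable]: "U \<in> M \<rightarrow>\<^sub>M mat_space d" "b \<in> M \<rightarrow>\<^sub>M vec_space d" "w \<in> M \<rightarrow>\<^sub>M vec_space d"
  shows "(\<lambda>x. verdict d (U x) (b x) (w x)) \<in> M \<rightarrow>\<^sub>M count_space UNIV"
  unfolding verdict_def by measurable

lemma rotation_test_eq: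
  "rotation_test d n \<mu> A = (\<lambda>p. \<mu> \<bind> (\<lambda>U. A (fst p) \<bind> (\<lambda>b.
     A (rotate_samples d n U (snd p)) \<bind> (\<lambda>w. return (count_space UNIV) (verdict d U b w)))))"
  by (simp add: rotation_test_def verdict_def Let_def case_prod_unfold fun_eq_iff)

lemma measurable_rotation_test:
  assumes A: "is_estimator d n A" and \<mu>: "uniform_rotation d \<mu>"
  shows "rotation_test d n \<mu> A \<in> sample_space d n \<Otimes>\<^sub>M sample_space d n \<rightarrow>\<^sub>M prob_algebra (count_space UNIV)"
proof -
  have [measurable]: "A \<in> sample_space d n \<rightarrow>\<^sub>M prob_algebra (vec_space d)"
    using A by (simp add: is_estimator_def)
  have [measurable]: "\<mu> \<in> space (prob_algebra (mat_space d))"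
    using \<mu> by (simp add: uniform_rotation_def space_prob_algebra)
  show ?thesis
    unfolding rotation_test_eq by measurable
qed

lemma measurable_nn_integral_kernel [measurable (raw)]:
  assumes "L \<in> M \<rightarrow>\<^sub>M prob_algebra N" "(\<lambda>p. f (fst p) (snd p)) \<in> borel_measurable (M \<Otimes>\<^sub>M N)"
  shows "(\<lambda>x. \<integral>\<^sup>+y. f x y \<partial>L x) \<in> borel_measurable M"
  using assms nn_integral_measurable_subprob_algebra2[of f M N L]
  by (simp add: case_prod_unfold measurable_prob_algebraD)

lemma rotate_samples_in_space [simp]: "rotate_samples d n U S \<in> space (sample_space d n)"
  by (auto simp: rotate_samples_def sample_space_def iid_def space_PiM space_pair_measure space_vec_space)

text \<open>For fixed \<open>U\<close> the two halves of the data and the two calls of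
  \<open>A\<close> are independent, so the test sees a pair \<open>(b, w)\<close> with a product
  law. The first factor does not involve \<open>U\<close>, and the second is the law of
  \<open>A\<close> on rotated data. Both error bounds start from this integral.\<close>

lemma emeasure_rotation_test:
  assumes A: "is_estimator d n A" and \<mu>: "uniform_rotation d \<mu>"
    and D: "prob_space D" "sets D = sets (vec_space d \<Otimes>\<^sub>M borel)"
  shows "emeasure (iid n D \<Otimes>\<^sub>M iid n D \<bind> rotation_test d n \<mu> A) X =
    (\<integral>\<^sup>+U. \<integral>\<^sup>+b. \<integral>\<^sup>+w. indicator X (verdict d U b w)
       \<partial>(distr (iid n D) (sample_space d n) (rotate_samples d n U) \<bind> A) \<partial>(iid n D \<bind> A) \<partial>\<mu>)"
proof -
  let ?I = "iid n D"
  let ?G = "\<lambda>U b w. indicator X (verdict d U b w) :: ennreal"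
  have A_meas [measurable]: "A \<in> sample_space d n \<rightarrow>\<^sub>M prob_algebra (vec_space d)"
    using A by (simp add: is_estimator_def)
  have sets_\<mu> [measurable_cong]: "sets \<mu> = sets (mat_space d)" and \<mu>_prob: "prob_space \<mu>"
    using \<mu> by (auto simp: uniform_rotation_def)
  then have \<mu>_space [measurable]: "\<mu> \<in> space (prob_algebra (mat_space d))"
    by (simp add: space_prob_algebra)
  have sets_I [measurable_cong]: "sets ?I = sets (sample_space d n)"
    using D(2) by (rule sets_iid_sample_space)
  have space_I: "space ?I = space (sample_space d n)" "space (?I \<Otimes>\<^sub>M ?I) = space (sample_space d n \<Otimes>\<^sub>M sample_space d n)"
    using sets_eq_imp_space_eq[OF sets_I] by (simp_all add: space_pair_measure)
  have space_\<mu>: "space \<mu> = space (mat_space d)" using sets_eq_imp_space_eq[OF sets_\<mu>] .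
  interpret I: prob_space ?I using D(1) by (rule prob_space_iid)
  interpret II: pair_prob_space ?I ?I ..
  interpret \<mu>: prob_space \<mu> by fact
  interpret II\<mu>: pair_sigma_finite "?I \<Otimes>\<^sub>M ?I" \<mu> ..
  have [measurable]: "X \<in> sets (count_space UNIV)" by simp
  have test: "emeasure (rotation_test d n \<mu> A p) X =
      (\<integral>\<^sup>+U. \<integral>\<^sup>+b. \<integral>\<^sup>+w. ?G U b w \<partial>A (rotate_samples d n U (snd p)) \<partial>A (fst p) \<partial>\<mu>)"
    if p: "p \<in> space (sample_space d n \<Otimes>\<^sub>M sample_space d n)" for p
  proof -
    have [measurable]: "fst p \<in> space (sample_space d n)" "snd p \<in> space (sample_space d n)"
      using p by (auto simp: space_pair_measure)
    have AS [measurable]: "A (fst p) \<in> space (prob_algebra (vec_space d))"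
      by (rule measurable_space[OF A_meas]) measurable
    let ?w = "\<lambda>U b. A (rotate_samples d n U (snd p)) \<bind> (\<lambda>w. return (count_space UNIV) (verdict d U b w))"
    have "emeasure (rotation_test d n \<mu> A p) X = (\<integral>\<^sup>+U. emeasure (A (fst p) \<bind> ?w U) X \<partial>\<mu>)"
      unfolding rotation_test_eq
      by (rule emeasure_bind_prob_algebra[where N="mat_space d" and L="count_space UNIV"]) measurable
    also have "\<dots> = (\<integral>\<^sup>+U. \<integral>\<^sup>+b. \<integral>\<^sup>+w. ?G U b w \<partial>A (rotate_samples d n U (snd p)) \<partial>A (fst p) \<partial>\<mu>)"
    proof (intro nn_integral_cong)
      fix U assume "U \<in> space \<mu>"
      then have [measurable]: "U \<in> space (mat_space d)" by (simp add: space_\<mu>)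
      have "emeasure (A (fst p) \<bind> ?w U) X = (\<integral>\<^sup>+b. emeasure (?w U b) X \<partial>A (fst p))"
        by (rule emeasure_bind_prob_algebra[where N="vec_space d" and L="count_space UNIV"]) measurable
      also have "\<dots> = (\<integral>\<^sup>+b. \<integral>\<^sup>+w. ?G U b w \<partial>A (rotate_samples d n U (snd p)) \<partial>A (fst p))"
      proof (intro nn_integral_cong)
        fix b assume "b \<in> space (A (fst p))"
        then have [measurable]: "b \<in> space (vec_space d)"
          using AS by (auto simp: space_prob_algebra dest: sets_eq_imp_space_eq)
        have "emeasure (?w U b) X = (\<integral>\<^sup>+w. emeasure (return (count_space UNIV) (verdict d U b w)) X
            \<partial>A (rotate_samples d n U (snd p)))"
          by (rule emeasure_bind_prob_algebra[where L="count_space UNIV", OF measurable_space[OF A_meas rotate_samples_in_space]]) measurable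
        then show "emeasure (?w U b) X = (\<integral>\<^sup>+w. ?G U b w \<partial>A (rotate_samples d n U (snd p)))"
          by simp
      qed
      finally show "emeasure (A (fst p) \<bind> ?w U) X =
        (\<integral>\<^sup>+b. \<integral>\<^sup>+w. ?G U b w \<partial>A (rotate_samples d n U (snd p)) \<partial>A (fst p))" .
    qed
    finally show ?thesis .
  qed
  have "emeasure (?I \<Otimes>\<^sub>M ?I \<bind> rotation_test d n \<mu> A) X =
      (\<integral>\<^sup>+p. emeasure (rotation_test d n \<mu> A p) X \<partial>(?I \<Otimes>\<^sub>M ?I))"
    using measurable_rotation_test[OF A \<mu>] sets_I
    by (intro emeasure_bind_prob_algebra[where N="sample_space d n \<Otimes>\<^sub>M sample_space d n" and L="count_space UNIV"]
      space_mem_prob_algebraI II.prob_space_axioms sets_pair_measure_cong) auto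
  also have "\<dots> = (\<integral>\<^sup>+p. \<integral>\<^sup>+U. \<integral>\<^sup>+b. \<integral>\<^sup>+w. ?G U b w \<partial>A (rotate_samples d n U (snd p)) \<partial>A (fst p) \<partial>\<mu> \<partial>(?I \<Otimes>\<^sub>M ?I))"
    by (intro nn_integral_cong) (simp add: test space_I)
  also have "\<dots> = (\<integral>\<^sup>+U. \<integral>\<^sup>+p. \<integral>\<^sup>+b. \<integral>\<^sup>+w. ?G U b w \<partial>A (rotate_samples d n U (snd p)) \<partial>A (fst p) \<partial>(?I \<Otimes>\<^sub>M ?I) \<partial>\<mu>)"
    by (rule II\<mu>.Fubini'[symmetric]) measurable
  also have "\<dots> = (\<integral>\<^sup>+U. \<integral>\<^sup>+b. \<integral>\<^sup>+w. ?G U b w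
       \<partial>(distr ?I (sample_space d n) (rotate_samples d n U) \<bind> A) \<partial>(?I \<bind> A) \<partial>\<mu>)"
  proof (intro nn_integral_cong)
    fix U assume "U \<in> space \<mu>"
    then have [measurable]: "U \<in> space (mat_space d)" by (simp add: space_\<mu>)
    let ?Q = "distr ?I (sample_space d n) (rotate_samples d n U)"
    have "(\<integral>\<^sup>+p. \<integral>\<^sup>+b. \<integral>\<^sup>+w. ?G U b w \<partial>A (rotate_samples d n U (snd p)) \<partial>A (fst p) \<partial>(?I \<Otimes>\<^sub>M ?I)) =
      (\<integral>\<^sup>+S. \<integral>\<^sup>+S'. \<integral>\<^sup>+b. \<integral>\<^sup>+w. ?G U b w \<partial>A (rotate_samples d n U S') \<partial>A S \<partial>?I \<partial>?I)"
      by (subst I.nn_integral_fst[symmetric]) simp_all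
    also have "\<dots> = (\<integral>\<^sup>+S. \<integral>\<^sup>+b. \<integral>\<^sup>+w. ?G U b w \<partial>(?Q \<bind> A) \<partial>A S \<partial>?I)"
    proof (intro nn_integral_cong)
      fix S assume "S \<in> space ?I"
      then have S [measurable]: "S \<in> space (sample_space d n)" by (simp add: space_I)
      have "A S \<in> space (prob_algebra (vec_space d))" by (rule measurable_space[OF A_meas S])
      then have AS: "sets (A S) = sets (vec_space d)" "prob_space (A S)"
        by (simp_all add: space_prob_algebra)
      note [measurable_cong] = AS(1)
      interpret AS: prob_space "A S" by (rule AS)
      interpret ASI: pair_sigma_finite "A S" ?I ..
      \<comment> \<open>Once \<open>S'\<close> is integrated next to \<open>w\<close>, the two
        integrals merge into one over the law of the second estimate.\<close>
      have "(\<integral>\<^sup>+S'. \<integral>\<^sup>+b. \<integral>\<^sup>+w. ?G U b w \<partial>A (rotate_samples d n U S') \<partial>A S \<partial>?I) =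
        (\<integral>\<^sup>+b. \<integral>\<^sup>+S'. \<integral>\<^sup>+w. ?G U b w \<partial>A (rotate_samples d n U S') \<partial>?I \<partial>A S)"
        by (rule ASI.Fubini') measurable
      also have "\<dots> = (\<integral>\<^sup>+b. \<integral>\<^sup>+w. ?G U b w \<partial>(?Q \<bind> A) \<partial>A S)"
      proof (intro nn_integral_cong)
        fix b assume "b \<in> space (A S)"
        then have [measurable]: "b \<in> space (vec_space d)" using sets_eq_imp_space_eq[OF AS(1)] by simp
        have "(\<integral>\<^sup>+w. ?G U b w \<partial>(?Q \<bind> A)) = (\<integral>\<^sup>+S'. \<integral>\<^sup>+w. ?G U b w \<partial>A S' \<partial>?Q)"
          by (rule nn_integral_bind[where B="vec_space d"]) (measurable, rule measurable_prob_algebraD, measurable)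
        also have "\<dots> = (\<integral>\<^sup>+S'. \<integral>\<^sup>+w. ?G U b w \<partial>A (rotate_samples d n U S') \<partial>?I)"
          by (rule nn_integral_distr) measurable
        finally show "(\<integral>\<^sup>+S'. \<integral>\<^sup>+w. ?G U b w \<partial>A (rotate_samples d n U S') \<partial>?I) = (\<integral>\<^sup>+w. ?G U b w \<partial>(?Q \<bind> A))" ..
      qed
      finally show "(\<integral>\<^sup>+S'. \<integral>\<^sup>+b. \<integral>\<^sup>+w. ?G U b w \<partial>A (rotate_samples d n U S') \<partial>A S \<partial>?I) = (\<integral>\<^sup>+b. \<integral>\<^sup>+w. ?G U b w \<partial>(?Q \<bind> A) \<partial>A S)" .
    qed
    also have "\<dots> = (\<integral>\<^sup>+b. \<integral>\<^sup>+w. ?G U b w \<partial>(?Q \<bind> A) \<partial>(?I \<bind> A))"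
    proof (rule nn_integral_bind[where B="vec_space d", symmetric])
      have "prob_space ?Q" by (rule I.prob_space_distr) measurable
      \<comment> \<open>\<open>?Q\<close> is treated as a constant kernel on a dummy space,
        evaluated at \<open>undefined\<close>, so that the rule for composing kernels
        applies.\<close>
      then have [measurable]: "?Q \<bind> A \<in> space (prob_algebra (vec_space d))"
        by (intro measurable_bind_prob_space[OF measurable_const, THEN measurable_space, of _ "sample_space d n" _ _ undefined "count_space UNIV"] space_mem_prob_algebraI)
          simp_all
      show "(\<lambda>b. \<integral>\<^sup>+w. ?G U b w \<partial>(?Q \<bind> A)) \<in> borel_measurable (vec_space d)" by measurable
      show "A \<in> ?I \<rightarrow>\<^sub>M subprob_algebra (vec_space d)"
        by (rule measurable_prob_algebraD) measurable
    qed
    finally show "(\<integral>\<^sup>+p. \<integral>\<^sup>+b. \<integral>\<^sup>+w. ?G U b w \<partial>A (rotate_samples d n U (snd p)) \<partial>A (fst p) \<partial>(?I \<Otimes>\<^sub>M ?I)) =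
      (\<integral>\<^sup>+b. \<integral>\<^sup>+w. ?G U b w \<partial>(?Q \<bind> A) \<partial>(?I \<bind> A))" .
  qed
  finally show ?thesis .
qed

section \<open>The normalised inner product and its threshold\<close>

lemma abs_dot_le: "\<bar>dot d x y\<bar> \<le> vnorm d x * vnorm d y"
proof -
  have "\<bar>dot d x y\<bar> \<le> (\<Sum>i<d. \<bar>x i\<bar> * \<bar>y i\<bar>)"
    unfolding dot_def by (rule order_trans[OF sum_abs]) (simp add: abs_mult)
  also have "\<dots> \<le> vnorm d x * vnorm d y"
    unfolding vnorm_def by (rule L2_set_mult_ineq)
  finally show ?thesis .
qed

lemma mat_app_vscale: "mat_app d U (vscale d c x) = vscale d c (mat_app d U x)"
  by (auto simp: mat_app_def vscale_def dot_scale_right fun_eq_iff)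

lemma dot_vscale:
  "dot d (vscale d c x) y = c * dot d x y" "dot d x (vscale d c y) = c * dot d x y"
  by (simp_all add: vscale_def dot_scale_left dot_scale_right)

lemma dot_normalize_vec:
  "dot d (normalize_vec d x) (normalize_vec d y) = dot d x y / (vnorm d x * vnorm d y)"
  by (simp add: normalize_vec_def dot_vscale)

text \<open>Write both vectors as \<open>\<beta>\<close> plus an error of length at most
  \<open>\<rho> / 4\<close>. The inner product is at least
  \<open>(1 - 1/4 - 1/4 - 1/16) \<rho>\<^sup>2 = 7/16 \<rho>\<^sup>2\<close>, and each squared norm
  is at most \<open>(1 + 1/2 + 1/16) \<rho>\<^sup>2 = 25/16 \<rho>\<^sup>2\<close>. The quotient is
  at least 7/25, which exceeds 1/9.\<close>

lemma dot_normalize_vec_close: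
  assumes \<beta>: "vnorm d \<beta> = \<rho>" "\<rho> > 0"
    and b: "vnorm d (vdiff d b \<beta>) \<le> \<rho> / 4" and c: "vnorm d (vdiff d c \<beta>) \<le> \<rho> / 4"
  shows "dot d (normalize_vec d b) (normalize_vec d c) > 1 / 9"
proof -
  have nn: "0 \<le> vnorm d x" for x by (rule vnorm_nonneg)
  have small: "\<bar>dot d x y\<bar> \<le> s * t" if "vnorm d x \<le> s" "vnorm d y \<le> t" for x y s t
    using that order_trans[OF nn that(1)] by (intro order_trans[OF abs_dot_le] mult_mono) (auto intro: vnorm_nonneg)
  have decomp: "dot d x y = \<rho>\<^sup>2 + dot d \<beta> (vdiff d y \<beta>) + dot d (vdiff d x \<beta>) \<beta> + dot d (vdiff d x \<beta>) (vdiff d y \<beta>)" for x y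
  proof -
    have diff: "dot d z (vdiff d y \<beta>) = dot d z y - dot d z \<beta>" "dot d (vdiff d x \<beta>) z = dot d x z - dot d \<beta> z" for z
      by (simp_all add: vdiff_def dot_linear)
    show ?thesis
      using vnorm_power2[of d \<beta>] by (simp add: diff \<beta>(1))
  qed
  have upper: "dot d x x \<le> 25 / 16 * \<rho>\<^sup>2" if "vnorm d (vdiff d x \<beta>) \<le> \<rho> / 4" for x
    using decomp[of x x] small[OF that that] small[OF that order_refl[of "vnorm d \<beta>"]] \<beta>(1)
      dot_commute[of d \<beta> "vdiff d x \<beta>"]
    by (simp add: power2_eq_square)
  have lower: "dot d b c \<ge> 7 / 16 * \<rho>\<^sup>2"
    using decomp[of b c] small[OF b c] small[OF b order_refl[of "vnorm d \<beta>"]]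
      small[OF order_refl[of "vnorm d \<beta>"] c] \<beta>(1)
    by (simp add: power2_eq_square)
  have le: "vnorm d x \<le> 5 / 4 * \<rho>" if "vnorm d (vdiff d x \<beta>) \<le> \<rho> / 4" for x
  proof (rule power2_le_imp_le)
    show "(vnorm d x)\<^sup>2 \<le> (5 / 4 * \<rho>)\<^sup>2"
      using upper[OF that] unfolding vnorm_power2 by (simp add: power2_eq_square)
  qed (use \<beta>(2) in simp)
  have prod_le: "vnorm d b * vnorm d c \<le> 25 / 16 * \<rho>\<^sup>2"
    using mult_mono[OF le[OF b] le[OF c]] \<beta>(2) by (simp add: vnorm_nonneg power2_eq_square)
  have "\<rho>\<^sup>2 > 0" using \<beta>(2) by simp
  then have pos: "dot d b c > 0" using lower by linarith
  moreover have "vnorm d b * vnorm d c \<ge> dot d b c" using abs_dot_le[of d b c] by linarith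
  ultimately show ?thesis
    unfolding dot_normalize_vec using lower prod_le \<open>\<rho>\<^sup>2 > 0\<close> by (subst pos_less_divide_eq) linarith+
qed

text \<open>A rotation commutes with normalisation, and the adjoint puts \<open>U\<close> on the
  first estimate; this is the shape in which the tail bound applies.\<close>

lemma dot_normalize_vec_rotate:
  assumes "is_rotation d U"
  shows "dot d (normalize_vec d b) (normalize_vec d (mat_app d (mat_transp d U) w)) =
    dot d (normalize_vec d w) (mat_app d U (normalize_vec d b))"
proof -
  have "normalize_vec d (mat_app d (mat_transp d U) w) = mat_app d (mat_transp d U) (normalize_vec d w)"
    by (simp add: normalize_vec_def mat_app_vscale rotation_transp_vnorm[OF assms])
  then show ?thesis
    by (metis dot_mat_app_left dot_commute)
qed

text \<open>The tail bound at \<open>r = 1/9\<close>, where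
  \<open>r\<^sup>2 / 2 = 1/162\<close>.\<close>

lemma emeasure_verdict_Alternate:
  assumes \<mu>: "uniform_rotation d \<mu>" and d: "d > 0"
    and b: "b \<in> space (vec_space d)" and w: "w \<in> space (vec_space d)"
  shows "(\<integral>\<^sup>+U. indicator {Alternate} (verdict d U b w) \<partial>\<mu>) \<le> ennreal (2 * exp (- real d / 162))"
proof -
  have sets [measurable_cong]: "sets \<mu> = sets (mat_space d)" and rot: "AE U in \<mu>. is_rotation d U"
    and "prob_space \<mu>"
    using \<mu> by (auto simp: uniform_rotation_def)
  then interpret prob_space \<mu> by simp
  note [measurable] = b w
  let ?b = "normalize_vec d b" and ?w = "normalize_vec d w"
  have unit: "dot d (normalize_vec d x) (normalize_vec d x) = 1" if "vnorm d x \<noteq> 0" for x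
    using vnorm_normalize_vec[OF that] vnorm_power2[of d "normalize_vec d x"] by simp
  let ?S = "{U \<in> space \<mu>. \<bar>dot d ?w (mat_app d U ?b)\<bar> > 1 / 9}"
  have nmem: "normalize_vec d x \<in> space (vec_space d)" for x
    by (simp add: normalize_vec_def vscale_def space_vec_space)
  note [measurable] = nmem[of b] nmem[of w]
  have "(\<integral>\<^sup>+U. indicator {Alternate} (verdict d U b w) \<partial>\<mu>) = (\<integral>\<^sup>+U. indicator ?S U \<partial>\<mu>)"
    using rot AE_space
    by (intro nn_integral_cong_AE, eventually_elim)
      (simp add: verdict_def dot_normalize_vec_rotate indicator_def)
  also have "\<dots> = emeasure \<mu> ?S"
    by (rule nn_integral_indicator) measurable
  also have "\<dots> \<le> ennreal (2 * exp (- real d / 162))"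
  \<comment> \<open>An estimator may return the zero vector, which has no direction. Its
    normalisation is zero, so the statistic vanishes and the verdict is never
    \<open>Alternate\<close>.\<close>
  proof (cases "vnorm d b = 0 \<or> vnorm d w = 0")
    case True
    then have "(\<forall>i<d. ?b i = 0) \<or> (\<forall>i<d. ?w i = 0)"
      by (auto simp: normalize_vec_def vscale_def vnorm_eq_sqrt_dot dot_self_eq_0_iff restrict_def)
    then have "dot d ?w (mat_app d U ?b) = 0" for U
      by (auto simp: dot_def mat_app_def)
    then show ?thesis by simp
  next
    case False
    then have "prob ?S \<le> 2 * exp (- (1 / 9)\<^sup>2 * real d / 2)"
      using unit by (intro uniform_rotation_tail[OF \<mu> d]) (auto simp: nmem)
    then show ?thesis
      by (simp add: emeasure_eq_measure power2_eq_square)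
  qed
  finally show ?thesis .
qed

section \<open>Error probabilities under the two hypotheses\<close>

lemma bind_in_space_prob_algebra:
  assumes "M \<in> space (prob_algebra N)" "f \<in> N \<rightarrow>\<^sub>M prob_algebra L"
  shows "M \<bind> f \<in> space (prob_algebra L)"
  by (rule space_mem_prob_algebraI[OF prob_space_bind'[OF assms] sets_bind'[OF assms]])

lemma prob_space_estimate:
  assumes A: "is_estimator d n A" and D: "prob_space D" "sets D = sets (vec_space d \<Otimes>\<^sub>M borel)"
  shows "iid n D \<bind> A \<in> space (prob_algebra (vec_space d))"
proof -
  have "iid n D \<in> space (prob_algebra (sample_space d n))"
    by (intro space_mem_prob_algebraI prob_space_iid sets_iid_sample_space D)
  moreover have "A \<in> sample_space d n \<rightarrow>\<^sub>M prob_algebra (vec_space d)"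
    using A by (simp add: is_estimator_def)
  ultimately show ?thesis
    by (rule bind_in_space_prob_algebra)
qed

text \<open>By \<open>inv\<close> the law of \<open>w\<close> is the same for almost every
  \<open>U\<close>. The three variables are then independent, and \<open>U\<close> can be integrated
  first, with \<open>b\<close> and \<open>w\<close> held fixed; nothing is assumed about the quality
  of the estimator.\<close>

lemma rotation_test_Alternate_le:
  assumes A: "is_estimator d n A" and \<mu>: "uniform_rotation d \<mu>" and d: "d > 0"
    and D: "prob_space D" "sets D = sets (vec_space d \<Otimes>\<^sub>M borel)"
    and inv: "\<And>U. is_rotation d U \<Longrightarrow> distr D (vec_space d \<Otimes>\<^sub>M borel) (rotate_sample d U) = D"
  shows "emeasure (iid n D \<Otimes>\<^sub>M iid n D \<bind> rotation_test d n \<mu> A) {Alternate}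
    \<le> ennreal (2 * exp (- real d / 162))"
proof -
  let ?Q = "iid n D \<bind> A" and ?G = "\<lambda>U b w. indicator {Alternate} (verdict d U b w) :: ennreal"
  have sets_\<mu> [measurable_cong]: "sets \<mu> = sets (mat_space d)" and rot: "AE U in \<mu>. is_rotation d U"
    and "prob_space \<mu>"
    using \<mu> by (auto simp: uniform_rotation_def)
  then interpret \<mu>: prob_space \<mu> by simp
  have Q [measurable]: "?Q \<in> space (prob_algebra (vec_space d))"
    by (rule prob_space_estimate[OF A D])
  then have sets_Q [measurable_cong]: "sets ?Q = sets (vec_space d)" and "prob_space ?Q"
    by (auto simp: space_prob_algebra)
  interpret Q: prob_space ?Q by fact
  interpret Q\<mu>: pair_sigma_finite \<mu> ?Q ..
  have space_Q: "space ?Q = space (vec_space d)" by (rule sets_eq_imp_space_eq[OF sets_Q])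
  have [measurable]: "{Alternate} \<in> sets (count_space UNIV)" by simp
  have "emeasure (iid n D \<Otimes>\<^sub>M iid n D \<bind> rotation_test d n \<mu> A) {Alternate} =
      (\<integral>\<^sup>+U. \<integral>\<^sup>+b. \<integral>\<^sup>+w. ?G U b w \<partial>?Q \<partial>?Q \<partial>\<mu>)"
    unfolding emeasure_rotation_test[OF A \<mu> D]
    using rot by (intro nn_integral_cong_AE, eventually_elim) (simp add: distr_rotate_samples D inv)
  also have "\<dots> = (\<integral>\<^sup>+b. \<integral>\<^sup>+U. \<integral>\<^sup>+w. ?G U b w \<partial>?Q \<partial>\<mu> \<partial>?Q)"
    by (rule Q\<mu>.Fubini'[symmetric]) measurable
  also have "\<dots> = (\<integral>\<^sup>+b. \<integral>\<^sup>+w. \<integral>\<^sup>+U. ?G U b w \<partial>\<mu> \<partial>?Q \<partial>?Q)"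
  proof (intro nn_integral_cong)
    fix b assume "b \<in> space ?Q"
    then have [measurable]: "b \<in> space (vec_space d)" by (simp add: space_Q)
    show "(\<integral>\<^sup>+U. \<integral>\<^sup>+w. ?G U b w \<partial>?Q \<partial>\<mu>) = (\<integral>\<^sup>+w. \<integral>\<^sup>+U. ?G U b w \<partial>\<mu> \<partial>?Q)"
      by (rule Q\<mu>.Fubini'[symmetric]) measurable
  qed
  also have "\<dots> \<le> (\<integral>\<^sup>+b. \<integral>\<^sup>+w. ennreal (2 * exp (- real d / 162)) \<partial>?Q \<partial>?Q)"
    by (intro nn_integral_mono emeasure_verdict_Alternate[OF \<mu> d]) (simp_all add: space_Q)
  also have "\<dots> = ennreal (2 * exp (- real d / 162))"
    by (simp add: Q.emeasure_space_1)
  finally show ?thesis .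
qed

lemma emeasure_estimate_far:
  assumes A: "is_estimator d n A" and est: "estimates_within d n E \<tau> \<delta> A"
    and E: "real_distribution E" and \<beta>: "\<beta> \<in> space (vec_space d)"
  shows "emeasure (iid n (P_model d \<beta> E) \<bind> A) {b \<in> space (vec_space d). \<not> vnorm d (vdiff d b \<beta>) \<le> \<tau>}
    \<le> ennreal \<delta>"
proof -
  let ?Q = "iid n (P_model d \<beta> E) \<bind> A"
  have "?Q \<in> space (prob_algebra (vec_space d))"
    by (rule prob_space_estimate[OF A prob_space_P_model[OF E \<beta>]]) simp
  then have sets_Q [measurable_cong]: "sets ?Q = sets (vec_space d)" and "prob_space ?Q"
    by (auto simp: space_prob_algebra)
  interpret Q: prob_space ?Q by fact
  have space_Q: "space ?Q = space (vec_space d)" by (rule sets_eq_imp_space_eq[OF sets_Q])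
  note [measurable] = \<beta>
  have "Q.prob {b \<in> space ?Q. \<not> vnorm d (vdiff d b \<beta>) \<le> \<tau>} = 1 - Q.prob {b \<in> space ?Q. vnorm d (vdiff d b \<beta>) \<le> \<tau>}"
    by (rule Q.prob_neg) measurable
  also have "\<dots> \<le> \<delta>"
    using est \<beta> unfolding estimates_within_def space_Q by force
  finally show ?thesis
    by (simp add: Q.emeasure_eq_measure space_Q ennreal_leI)
qed

text \<open>The second call of \<open>A\<close> sees data with regression vector
  \<open>U \<beta>\<close>, so the guarantee is used at two parameters; it is available there
  because it holds for every \<open>\<beta>\<close>. A wrong verdict forces one of the two estimates
  to be far off, and the union bound gives \<open>2 * \<delta>\<close>.\<close>

lemma rotation_test_Null_le:
  assumes A: "is_estimator d n A" and \<mu>: "uniform_rotation d \<mu>"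
    and est: "estimates_within d n E \<tau> \<delta> A" and E: "real_distribution E"
    and \<beta>: "\<beta> \<in> space (vec_space d)" "vnorm d \<beta> = \<rho>" "\<rho> > 0" and \<tau>: "\<tau> \<le> \<rho> / 4" and \<delta>: "\<delta> \<ge> 0"
  shows "emeasure (iid n (P_model d \<beta> E) \<Otimes>\<^sub>M iid n (P_model d \<beta> E) \<bind> rotation_test d n \<mu> A) {Null}
    \<le> ennreal (2 * \<delta>)"
proof -
  let ?Q = "\<lambda>\<beta>. iid n (P_model d \<beta> E) \<bind> A"
  let ?F = "\<lambda>\<beta>. {b \<in> space (vec_space d). \<not> vnorm d (vdiff d b \<beta>) \<le> \<tau>}"
  have rot: "AE U in \<mu>. is_rotation d U" and "prob_space \<mu>"
    using \<mu> by (auto simp: uniform_rotation_def)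
  then interpret \<mu>: prob_space \<mu> by simp
  have P: "prob_space (P_model d \<beta> E)" by (rule prob_space_P_model[OF E \<beta>(1)])
  have F [measurable]: "?F \<gamma> \<in> sets (vec_space d)" if [measurable]: "\<gamma> \<in> space (vec_space d)" for \<gamma>
    by measurable
  have Q: "prob_space (?Q \<gamma>)" "sets (?Q \<gamma>) = sets (vec_space d)" if "\<gamma> \<in> space (vec_space d)" for \<gamma>
    using prob_space_estimate[OF A prob_space_P_model[OF E that]] by (auto simp: space_prob_algebra)
  have "emeasure (iid n (P_model d \<beta> E) \<Otimes>\<^sub>M iid n (P_model d \<beta> E) \<bind> rotation_test d n \<mu> A) {Null} =
      (\<integral>\<^sup>+U. \<integral>\<^sup>+b. \<integral>\<^sup>+w. indicator {Null} (verdict d U b w) \<partial>?Q (mat_app d U \<beta>) \<partial>?Q \<beta> \<partial>\<mu>)"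
    unfolding emeasure_rotation_test[OF A \<mu> P sets_P_model]
    using rot by (intro nn_integral_cong_AE, eventually_elim)
      (simp add: distr_rotate_samples P rotate_sample_P_model E \<beta>(1))
  also have "\<dots> \<le> (\<integral>\<^sup>+U. ennreal (2 * \<delta>) \<partial>\<mu>)"
  proof (rule nn_integral_mono_AE)
    show "AE U in \<mu>. (\<integral>\<^sup>+b. \<integral>\<^sup>+w. indicator {Null} (verdict d U b w) \<partial>?Q (mat_app d U \<beta>) \<partial>?Q \<beta>) \<le> ennreal (2 * \<delta>)"
      using rot
    proof eventually_elim
      case U: (elim U)
      have \<gamma>: "mat_app d U \<beta> \<in> space (vec_space d)" by (simp add: space_vec_space)
      interpret Q1: prob_space "?Q \<beta>" by (rule Q[OF \<beta>(1)])
      interpret Q2: prob_space "?Q (mat_app d U \<beta>)" by (rule Q[OF \<gamma>])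
      note sets_Q [measurable_cong] = Q(2)[OF \<beta>(1)] Q(2)[OF \<gamma>]
      note space_Q = sets_Q[THEN sets_eq_imp_space_eq]
      have le: "indicator {Null} (verdict d U b w) \<le> (indicator (?F \<beta>) b + indicator (?F (mat_app d U \<beta>)) w :: ennreal)"
        if b: "b \<in> space (vec_space d)" and w: "w \<in> space (vec_space d)" for b w
      proof (cases "b \<in> ?F \<beta> \<or> w \<in> ?F (mat_app d U \<beta>)")
        case False
        \<comment> \<open>Rotating back is an isometry: the error of \<open>w\<close> as an estimate
          of \<open>U \<beta>\<close> equals the error of its back-rotation as an estimate of
          \<open>\<beta>\<close>.\<close>
        have "mat_app d U (vdiff d (mat_app d (mat_transp d U) w) \<beta>) = vdiff d w (mat_app d U \<beta>)"
          using w by (simp add: mat_app_vdiff rotation_mat_app_transp[OF U] space_vec_space)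
        then have "vnorm d (vdiff d (mat_app d (mat_transp d U) w) \<beta>) = vnorm d (vdiff d w (mat_app d U \<beta>))"
          using rotation_vnorm[OF U] by metis
        then have "dot d (normalize_vec d b) (normalize_vec d (mat_app d (mat_transp d U) w)) > 1 / 9"
          using False b w \<tau> by (intro dot_normalize_vec_close[OF \<beta>(2,3)]) auto
        then show ?thesis by (simp add: verdict_def)
      qed (auto simp: indicator_def)
      have "(\<integral>\<^sup>+b. \<integral>\<^sup>+w. indicator {Null} (verdict d U b w) \<partial>?Q (mat_app d U \<beta>) \<partial>?Q \<beta>) \<le>
          (\<integral>\<^sup>+b. \<integral>\<^sup>+w. indicator (?F \<beta>) b + indicator (?F (mat_app d U \<beta>)) w \<partial>?Q (mat_app d U \<beta>) \<partial>?Q \<beta>)"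
        using le by (intro nn_integral_mono) (auto simp: space_Q)
      also have "\<dots> = emeasure (?Q \<beta>) (?F \<beta>) + emeasure (?Q (mat_app d U \<beta>)) (?F (mat_app d U \<beta>))"
        using F[OF \<beta>(1)] F[OF \<gamma>]
        by (simp add: nn_integral_add Q1.emeasure_space_1 Q2.emeasure_space_1)
      also have "\<dots> \<le> ennreal \<delta> + ennreal \<delta>"
        by (intro add_mono emeasure_estimate_far[OF A est E] \<beta>(1) \<gamma>)
      also have "\<dots> = ennreal (2 * \<delta>)"
        using \<delta> by (simp flip: ennreal_plus)
      finally show ?case .
    qed
  qed
  also have "\<dots> = ennreal (2 * \<delta>)"
    by (simp add: \<mu>.emeasure_space_1)
  finally show ?thesis .
qed

text \<open>There are only two verdicts, so bounding the mass of the wrong one suffices; upper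
  bounds are what the integral estimates provide.\<close>

lemma measure_hypothesis_ge:
  assumes M: "M \<in> space (prob_algebra (count_space UNIV))" and "h \<noteq> h'"
    and le: "emeasure M {h'} \<le> ennreal p" and p: "p \<ge> 0"
  shows "measure M {h :: hypothesis} \<ge> 1 - p"
proof -
  have sets: "sets M = sets (count_space UNIV)" and "prob_space M"
    using M by (auto simp: space_prob_algebra)
  interpret prob_space M by fact
  have "{h} = space M - {h'}"
    using \<open>h \<noteq> h'\<close> sets_eq_imp_space_eq[OF sets] by (cases h; cases h') (auto intro: hypothesis.exhaust)
  then have "prob {h} = 1 - prob {h'}"
    using prob_compl[of "{h'}"] sets by simp
  then show ?thesis
    using le p by (simp add: emeasure_eq_measure)
qed

theorem theoremC1:
  "\<exists>C::real. C > 0 \<and>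
     (\<forall>(d::nat) (n::nat) (\<alpha>::real) (\<rho>::real) (\<tau>::real) (\<delta>::real) (E::real measure)
        (A :: samples \<Rightarrow> (nat \<Rightarrow> real) measure) (\<mu> :: (nat \<Rightarrow> nat \<Rightarrow> real) measure).
        0 < \<alpha> \<longrightarrow> \<alpha> < 1 \<longrightarrow> 0 < \<rho> \<longrightarrow> 0 < \<tau> \<longrightarrow> 0 < \<delta> \<longrightarrow> \<delta> < 1 \<longrightarrow>
        real_distribution E \<longrightarrow> measure E {0} \<ge> \<alpha> \<longrightarrow>
        is_estimator d n A \<longrightarrow> estimates_within d n E \<tau> \<delta> A \<longrightarrow>
        uniform_rotation d \<mu> \<longrightarrow>
        \<tau> \<le> \<rho> / 4 \<longrightarrow> real d \<ge> C * ln (1 / \<delta>) \<longrightarrow>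
        solves_test d n \<rho> E (rotation_test d n \<mu> A) (1 - 2 * \<delta>))"
proof (intro exI[of _ 162] conjI allI impI)
  fix d n :: nat and \<alpha> \<rho> \<tau> \<delta> :: real and E :: "real measure"
    and A :: "samples \<Rightarrow> (nat \<Rightarrow> real) measure" and \<mu> :: "(nat \<Rightarrow> nat \<Rightarrow> real) measure"
  assume \<rho>: "0 < \<rho>" and \<delta>: "0 < \<delta>" "\<delta> < 1" and E: "real_distribution E"
    and A: "is_estimator d n A" and est: "estimates_within d n E \<tau> \<delta> A"
    and \<mu>: "uniform_rotation d \<mu>" and \<tau>: "\<tau> \<le> \<rho> / 4" and dim: "real d \<ge> 162 * ln (1 / \<delta>)"
  have "ln (1 / \<delta>) > 0" using \<delta> by simp
  with dim have d: "d > 0" by (cases "d = 0") auto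
  have "- real d / 162 \<le> ln \<delta>"
    using dim \<delta> by (simp add: ln_div)
  then have exp_le: "exp (- real d / 162) \<le> \<delta>"
    using \<delta> by (metis exp_le_cancel_iff exp_ln)
  let ?T = "rotation_test d n \<mu> A"
  let ?SS = "sample_space d n \<Otimes>\<^sub>M sample_space d n"
  have T: "?T \<in> ?SS \<rightarrow>\<^sub>M prob_algebra (count_space UNIV)"
    by (rule measurable_rotation_test[OF A \<mu>])
  have bind_T: "M \<bind> ?T \<in> space (prob_algebra (count_space UNIV))" if "M \<in> space (prob_algebra ?SS)" for M
    using that T by (rule bind_in_space_prob_algebra)
  have data: "iid n D \<Otimes>\<^sub>M iid n D \<in> space (prob_algebra ?SS)"
    if "prob_space D" "sets D = sets (vec_space d \<Otimes>\<^sub>M borel)" for D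
    using that by (intro space_mem_prob_algebraI prob_space_pair prob_space_iid sets_pair_measure_cong sets_iid_sample_space)
  have null: "measure (null_data d n \<rho> E \<bind> ?T) {Null} \<ge> 1 - 2 * \<delta>"
  proof -
    let ?D = "std_gauss d \<Otimes>\<^sub>M R_star \<rho> E"
    have D: "prob_space ?D" "sets ?D = sets (vec_space d \<Otimes>\<^sub>M borel)"
      by (intro prob_space_pair prob_space_std_gauss prob_space_R_star[OF E \<rho>] sets_pair_measure_cong; simp)+
    have "emeasure (null_data d n \<rho> E \<bind> ?T) {Alternate} \<le> ennreal (2 * exp (- real d / 162))"
      unfolding null_data_def
      by (intro rotation_test_Alternate_le A \<mu> d D rotate_sample_gauss_pair prob_space_R_star E \<rho>) simp_all
    also have "\<dots> \<le> ennreal (2 * \<delta>)"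
      using exp_le by (intro ennreal_leI) simp
    finally show ?thesis
      using \<delta> data[OF D]
      by (intro measure_hypothesis_ge[of _ Null Alternate] bind_T) (simp_all add: null_data_def)
  qed
  have alternate: "measure (alternate_data d n \<rho> E \<bind> ?T) {Alternate} \<ge> 1 - 2 * \<delta>"
  proof -
    let ?K = "\<lambda>v. iid n (P_model d (vscale d \<rho> v) E) \<Otimes>\<^sub>M iid n (P_model d (vscale d \<rho> v) E)"
    have sphere: "uniform_sphere d \<in> space (prob_algebra (vec_space d))"
      by (intro space_mem_prob_algebraI prob_space_uniform_sphere) simp
    interpret sphere: prob_space "uniform_sphere d" by (rule prob_space_uniform_sphere)
    have "(\<lambda>v. iid n (P_model d (vscale d \<rho> v) E)) \<in> vec_space d \<rightarrow>\<^sub>M prob_algebra (sample_space d n)"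
      by (rule measurable_compose[OF _ measurable_iid_P_model[OF E]]) measurable
    then have K: "?K \<in> vec_space d \<rightarrow>\<^sub>M prob_algebra ?SS"
      by measurable
    have vscale: "vscale d c v \<in> space (vec_space d)" for c v
      by (simp add: vscale_def space_vec_space)
    \<comment> \<open>Conditioning on the hidden direction: for fixed \<open>v\<close> all samples
      are independent with a regression vector of length \<open>\<rho>\<close>, and the bound is
      uniform over almost every \<open>v\<close>.\<close>
    have "emeasure (alternate_data d n \<rho> E \<bind> ?T) {Null} =
        emeasure (uniform_sphere d \<bind> (\<lambda>v. ?K v \<bind> ?T)) {Null}"
      unfolding alternate_data_def
      using K T by (subst bind_assoc[where N="?SS" and R="count_space UNIV"])
        (auto intro!: measurable_prob_algebraD cong: measurable_cong_sets)
    also have "\<dots> = (\<integral>\<^sup>+v. emeasure (?K v \<bind> ?T) {Null} \<partial>uniform_sphere d)"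
      by (rule emeasure_bind_prob_algebra[OF sphere measurable_bind_prob_space[OF K T]]) simp
    also have "\<dots> \<le> (\<integral>\<^sup>+v. ennreal (2 * \<delta>) \<partial>uniform_sphere d)"
    proof (rule nn_integral_mono_AE)
      show "AE v in uniform_sphere d. emeasure (?K v \<bind> ?T) {Null} \<le> ennreal (2 * \<delta>)"
        using AE_uniform_sphere[OF d]
      proof eventually_elim
        case (elim v)
        then have "vnorm d (vscale d \<rho> v) = \<rho>"
          using \<rho> by (simp add: vnorm_vscale)
        then show ?case
          using \<delta> by (intro rotation_test_Null_le[OF A \<mu> est E vscale _ \<rho> \<tau>]) simp_all
      qed
    qed
    also have "\<dots> = ennreal (2 * \<delta>)"
      by (simp add: sphere.emeasure_space_1)
    finally show ?thesis
      using \<delta> bind_in_space_prob_algebra[OF sphere K]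
      by (intro measure_hypothesis_ge[of _ Alternate Null] bind_T) (simp_all add: alternate_data_def)
  qed
  show "solves_test d n \<rho> E ?T (1 - 2 * \<delta>)"
    unfolding solves_test_def using null alternate by blast
qed simp

end
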